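(* In the log-Gaussian setting described in the context, let $J=\{j\le d:\ \beta_j=\max_{1\le i\le d}\beta_i\}$ and assume: for every $c>0$ and every $\epsilon>0$ there exists $u_0>0$ such that for all $u>u_0$, all $j\in J$ and all $i\le d$ with $i\neq j$, $$\sigma_{ij}(u)+c\sqrt{\frac{1-\sigma_{ij}(u)^2}{\log u}}\ \le\ \frac{\beta_j}{\beta_i}\,\frac{\log\big(\epsilon\, e_i^*(u)\big)}{\log u}.$$ Then the modified Asmussen–Kroese estimator $Z_{MAK}(u)$ is an unbiased estimator of $\alpha(u)=\mathbb P(S(u)>u)$ and has asymptotically vanishing relative error, i.e. $$\lim_{u\to\infty}\frac{\mathbb E\big[Z_{MAK}(u)^2\big]}{\alpha(u)^2}=1 .$$
   Context: Let $d\ge 2$ and let $\mathbf N=(N_1,\dots,N_d)^\top$ be a vector of independent standard Gaussian random variables. For each $u>0$ let $\Sigma_u=(\sigma_{ij}(u))$ be a positive definite correlation matrix ($\sigma_{ii}(u)=1$). Let $\lambda_1,\dots,\lambda_d>0$, $\beta_1,\dots,\beta_d>0$, and let $\gamma_u>0$ be constants with $\gamma_u\to\gamma\in(0,\infty)$ as $u\to\infty$. For each $j\le d$ and $u>0$ let $A_u^{(j)}$ be a non-singular $d\times d$ matrix with $A_u^{(j)}(A_u^{(j)})^\top=\Sigma_u$ whose $j$-th row is the $j$-th unit vector (e.g. a Cholesky factor after permuting coordinate $j$ to the first position); set $\mathbf Y(u)=A_u^{(j)}\mathbf N$ (so $Y_j(u)=N_j$; the law of $\mathbf Y(u)$ is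 $N(0,\Sigma_u)$ regardless of $j$), $X_i(u)=\lambda_i e^{\beta_i\gamma_u Y_i(u)}$, $S(u)=\sum_{i=1}^d X_i(u)$, $M(u)=\max_{i\le d}X_i(u)$, and $\alpha(u)=\mathbb P(S(u)>u)$. Define $$Z_j(u)=\mathbb P\big(S(u)>u,\ X_j(u)=M(u)\ \big|\ N_k,\ k\neq j\big),$$ computed with $\mathbf Y(u)=A_u^{(j)}\mathbf N$. Let $p_i(u)=\mathbb P(X_i(u)>u)$ and let $\mathcal I$ be a random index independent of $\mathbf N$ with $\mathbb P(\mathcal I=i)=p_i(u)/\sum_{k=1}^d p_k(u)$. The modified Asmussen–Kroese estimator is $$Z_{MAK}(u)=\Big(\sum_{k=1}^d p_k(u)\Big)\sum_{i=1}^d \mathbb I_{\{\mathcal I=i\}}\frac{Z_i(u)}{p_i(u)}.$$ Finally, for $u>\max_i\lambda_i$, $e_i^*(u)=\dfrac{(\beta_i\gamma_u)^2\,u}{\log(u/\lambda_i)}$ (this is $\beta_i\gamma_u u\, e(w)/w$ with $w=(u/\lambda_i)^{1/(\beta_i\gamma_u)}$ and $e(x)=x/\log x$). *)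

theory Defs
  imports "HOL-Probability.Probability"
begin

text \<open>Coordinates are indexed by 0,...,d-1. A vector is a function nat => real
  (extensional on {..<d}); a d x d matrix is a function nat => nat => real.\<close>

definition std_gauss :: "real measure" where
  "std_gauss = density lborel (\<lambda>x. ennreal (std_normal_density x))"

definition gaussN :: "nat \<Rightarrow> (nat \<Rightarrow> real) measure" where
  "gaussN d = PiM {..<d} (\<lambda>_. std_gauss)"

definition Yv :: "nat \<Rightarrow> (nat \<Rightarrow> nat \<Rightarrow> real) \<Rightarrow> (nat \<Rightarrow> real) \<Rightarrow> nat \<Rightarrow> real" where
  "Yv d Aj n i = (\<Sum>k<d. Aj i k * n k)"

definition Xv :: "nat \<Rightarrow> (nat \<Rightarrow> real) \<Rightarrow> (nat \<Rightarrow> real) \<Rightarrow> real \<Rightarrow>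
    (nat \<Rightarrow> nat \<Rightarrow> real) \<Rightarrow> (nat \<Rightarrow> real) \<Rightarrow> nat \<Rightarrow> real" where
  "Xv d lam beta gu Aj n i = lam i * exp (beta i * gu * Yv d Aj n i)"

definition Ssum :: "nat \<Rightarrow> (nat \<Rightarrow> real) \<Rightarrow> (nat \<Rightarrow> real) \<Rightarrow> real \<Rightarrow>
    (nat \<Rightarrow> nat \<Rightarrow> real) \<Rightarrow> (nat \<Rightarrow> real) \<Rightarrow> real" where
  "Ssum d lam beta gu Aj n = (\<Sum>i<d. Xv d lam beta gu Aj n i)"

definition Mmax :: "nat \<Rightarrow> (nat \<Rightarrow> real) \<Rightarrow> (nat \<Rightarrow> real) \<Rightarrow> real \<Rightarrow>
    (nat \<Rightarrow> nat \<Rightarrow> real) \<Rightarrow> (nat \<Rightarrow> real) \<Rightarrow> real" where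
  "Mmax d lam beta gu Aj n = Max ((Xv d lam beta gu Aj n) ` {..<d})"

definition alpha_j :: "nat \<Rightarrow> (nat \<Rightarrow> real) \<Rightarrow> (nat \<Rightarrow> real) \<Rightarrow> real \<Rightarrow>
    (nat \<Rightarrow> nat \<Rightarrow> real) \<Rightarrow> real \<Rightarrow> real" where
  "alpha_j d lam beta gu Aj u = measure (gaussN d) {n \<in> space (gaussN d). Ssum d lam beta gu Aj n > u}"

text \<open>Z_j(u) = P(S(u) > u, X_j(u) = M(u) | N_k, k ~= j), computed with A_u^(j):
  by independence of the N_k, this conditional probability (as a function of the
  conditioning variables) integrates out the coordinate N_j against its law.\<close>
definition Zcond :: "nat \<Rightarrow> (nat \<Rightarrow> real) \<Rightarrow> (nat \<Rightarrow> real) \<Rightarrow> real \<Rightarrow>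
    (nat \<Rightarrow> nat \<Rightarrow> real) \<Rightarrow> real \<Rightarrow> nat \<Rightarrow> (nat \<Rightarrow> real) \<Rightarrow> real" where
  "Zcond d lam beta gu Aj u j n = measure std_gauss
     {t \<in> space std_gauss. Ssum d lam beta gu Aj (n(j := t)) > u \<and>
        Xv d lam beta gu Aj (n(j := t)) j = Mmax d lam beta gu Aj (n(j := t))}"

text \<open>p_i(u) = P(X_i(u) > u), where Y_i(u) is standard Gaussian.\<close>
definition ptail :: "(nat \<Rightarrow> real) \<Rightarrow> (nat \<Rightarrow> real) \<Rightarrow> real \<Rightarrow> real \<Rightarrow> nat \<Rightarrow> real" where
  "ptail lam beta gu u i = measure std_gauss {y \<in> space std_gauss. lam i * exp (beta i * gu * y) > u}"

definition index_law :: "nat \<Rightarrow> (nat \<Rightarrow> real) \<Rightarrow> (nat \<Rightarrow> real) \<Rightarrow> real \<Rightarrow> real \<Rightarrow> nat measure" where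
  "index_law d lam beta gu u = density (count_space {..<d})
     (\<lambda>i. ennreal (ptail lam beta gu u i / (\<Sum>k<d. ptail lam beta gu u k)))"

definition jointNI :: "nat \<Rightarrow> (nat \<Rightarrow> real) \<Rightarrow> (nat \<Rightarrow> real) \<Rightarrow> real \<Rightarrow> real \<Rightarrow> ((nat \<Rightarrow> real) \<times> nat) measure" where
  "jointNI d lam beta gu u = gaussN d \<Otimes>\<^sub>M index_law d lam beta gu u"

definition Z_MAK :: "nat \<Rightarrow> (nat \<Rightarrow> real) \<Rightarrow> (nat \<Rightarrow> real) \<Rightarrow> real \<Rightarrow>
    (nat \<Rightarrow> nat \<Rightarrow> nat \<Rightarrow> real) \<Rightarrow> real \<Rightarrow> (nat \<Rightarrow> real) \<times> nat \<Rightarrow> real" where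
  "Z_MAK d lam beta gu A u \<omega> = (\<Sum>k<d. ptail lam beta gu u k) *
     (\<Sum>i<d. (if snd \<omega> = i then 1 else 0) * Zcond d lam beta gu (A i) u i (fst \<omega>) / ptail lam beta gu u i)"

definition e_star :: "(nat \<Rightarrow> real) \<Rightarrow> (nat \<Rightarrow> real) \<Rightarrow> real \<Rightarrow> real \<Rightarrow> nat \<Rightarrow> real" where
  "e_star lam beta gu u i = (beta i * gu)\<^sup>2 * u / ln (u / lam i)"

end

theory Submission
  imports Defs "HOL-Real_Asymp.Real_Asymp"
begin

text \<open>
  With \<open>A\<^sup>(\<^sup>j\<^sup>)\<close> one has \<open>Y\<^sub>i = \<sigma>\<^sub>i\<^sub>j N\<^sub>j + W\<^sub>i\<close>, where the residual \<open>W\<^sub>i\<close> does not involve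
  \<open>N\<^sub>j\<close> and has variance \<open>1 - \<sigma>\<^sub>i\<^sub>j\<^sup>2\<close>. Let \<open>y\<close> be the level of \<open>N\<^sub>j\<close> at which \<open>X\<^sub>j = u\<close>. For \<open>j\<close> in \<open>J\<close>, the
  correlation condition with \<open>c\<close> proportional to \<open>K\<close> says that all other \<open>X\<^sub>i\<close> are at most
  \<open>\<delta> u / ln u\<close> at \<open>N\<^sub>j = y\<close>, as soon as \<open>W\<^sub>i \<le> K sqrt ((1 - \<sigma>\<^sub>i\<^sub>j\<^sup>2) ln u)\<close> for all \<open>i\<close>. On this event
  \<open>p\<^sub>j(u) \<le> Z\<^sub>j \<le> P(X\<^sub>j > u - d\<^sup>2 \<delta> u / ln u)\<close>, and the upper bound is close to \<open>p\<^sub>j(u)\<close> for small \<open>\<delta>\<close>.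
  The complement has probability \<open>O(u powr (- K\<^sup>2 / 2))\<close>; there the crude bound \<open>Z\<^sub>j \<le> P(X\<^sub>j > u / d)\<close>
  suffices, because it exceeds \<open>p\<^sub>j(u)\<close> by at most a fixed power of \<open>u\<close> and \<open>K\<close> is at our disposal.
  For \<open>j\<close> outside \<open>J\<close> the crude bound alone makes the contribution negligible. Unbiasedness needs
  that the law of \<open>A N\<close> depends on \<open>A A\<^sup>T\<close> only and that ties have probability zero.
\<close>

section \<open>Uniqueness of laws on finite products of the real line\<close>

text \<open>The weights turn \<open>M\<close> and \<open>M'\<close> into finite measures of equal
  mass. The phases \<open>r = 0\<close> and \<open>r = - pi / 2\<close> supply the real and
  imaginary parts of the characteristic functions of the images under \<open>X\<close> and
  \<open>X'\<close>, so Levy's uniqueness theorem applies.\<close>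

lemma integral_indicator_eq_of_cos_transform:
  fixes X w :: "'a \<Rightarrow> real" and X' w' :: "'b \<Rightarrow> real"
  assumes M: "prob_space M" and M': "prob_space M'"
    and X: "X \<in> borel_measurable M" and X': "X' \<in> borel_measurable M'"
    and w: "w \<in> borel_measurable M" and w': "w' \<in> borel_measurable M'"
    and w_bd: "\<And>x. 0 \<le> w x \<and> w x \<le> C" and w'_bd: "\<And>x. 0 \<le> w' x \<and> w' x \<le> C"
    and eq: "\<And>t r. (\<integral>x. w x * cos (t * X x + r) \<partial>M) = (\<integral>x. w' x * cos (t * X' x + r) \<partial>M')"
    and B: "B \<in> sets borel"
  shows "(\<integral>x. w x * indicator B (X x) \<partial>M) = (\<integral>x. w' x * indicator B (X' x) \<partial>M')"
proof -
  note [measurable] = X X' w w' B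
  interpret M: prob_space M by fact
  interpret M': prob_space M' by fact
  have int: "integrable M (\<lambda>x. w x * f x)"
    if "f \<in> borel_measurable M" "\<And>x. \<bar>f x\<bar> \<le> 1" for f :: "'a \<Rightarrow> real"
  proof (rule M.integrable_const_bound[where B = C])
    have "w x * \<bar>f x\<bar> \<le> C * 1" for x
      using that(2) w_bd order_trans[of 0 "w x" C] by (intro mult_mono) auto
    then show "AE x in M. norm (w x * f x) \<le> C"
      using w_bd by (auto simp: abs_mult)
  qed (use that in measurable)
  have int': "integrable M' (\<lambda>x. w' x * f x)"
    if "f \<in> borel_measurable M'" "\<And>x. \<bar>f x\<bar> \<le> 1" for f :: "'b \<Rightarrow> real"
  proof (rule M'.integrable_const_bound[where B = C])
    have "w' x * \<bar>f x\<bar> \<le> C * 1" for x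
      using that(2) w'_bd order_trans[of 0 "w' x" C] by (intro mult_mono) auto
    then show "AE x in M'. norm (w' x * f x) \<le> C"
      using w'_bd by (auto simp: abs_mult)
  qed (use that in measurable)
  define m where "m = (\<integral>x. w x \<partial>M)"
  have m': "m = (\<integral>x. w' x \<partial>M')"
    using eq[of 0 0] by (simp add: m_def)
  have iw: "integrable M w" using int[of "\<lambda>_. 1"] by simp
  have iw': "integrable M' w'" using int'[of "\<lambda>_. 1"] by simp
  show ?thesis
  \<comment> \<open>Levy's theorem concerns probability laws, so the weights are divided by their
    mass \<open>m\<close>. For \<open>m = 0\<close> they vanish almost everywhere and both sides are
    zero.\<close>
  proof (cases "m = 0")
    case True
    have "AE x in M. w x = 0"
      using True integral_nonneg_eq_0_iff_AE[OF iw] w_bd by (simp add: m_def)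
    then have "(\<integral>x. w x * indicator B (X x) \<partial>M) = 0"
      by (intro integral_eq_zero_AE) auto
    moreover have "AE x in M'. w' x = 0"
      using True integral_nonneg_eq_0_iff_AE[OF iw'] w'_bd by (simp add: m')
    then have "(\<integral>x. w' x * indicator B (X' x) \<partial>M') = 0"
      by (intro integral_eq_zero_AE) auto
    ultimately show ?thesis by simp
  next
    case False
    then have m_pos: "m > 0"
      using integral_nonneg_AE[of w M] w_bd by (auto simp: m_def less_le)
    define \<mu> where "\<mu> = distr (density M (\<lambda>x. ennreal (w x / m))) borel X"
    define \<mu>' where "\<mu>' = distr (density M' (\<lambda>x. ennreal (w' x / m))) borel X'"
    have LINT_\<mu>: "integral\<^sup>L \<mu> f = (\<integral>x. (w x / m) *\<^sub>R f (X x) \<partial>M)"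
      if [measurable]: "f \<in> borel_measurable borel" for f :: "real \<Rightarrow> 'c::{banach,second_countable_topology}"
      unfolding \<mu>_def using w_bd m_pos
      by (subst integral_distr) (auto simp: integral_density)
    have LINT_\<mu>': "integral\<^sup>L \<mu>' f = (\<integral>x. (w' x / m) *\<^sub>R f (X' x) \<partial>M')"
      if [measurable]: "f \<in> borel_measurable borel" for f :: "real \<Rightarrow> 'c::{banach,second_countable_topology}"
      unfolding \<mu>'_def using w'_bd m_pos
      by (subst integral_distr) (auto simp: integral_density)
    have "prob_space (density M (\<lambda>x. ennreal (w x / m)))"
    proof
      have "emeasure (density M (\<lambda>x. ennreal (w x / m))) (space M) = (\<integral>\<^sup>+x. ennreal (w x / m) \<partial>M)"
        by (subst emeasure_density) (auto cong: nn_integral_cong_simp)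
      also have "\<dots> = ennreal (\<integral>x. w x / m \<partial>M)"
        using iw w_bd m_pos by (intro nn_integral_eq_integral) auto
      also have "\<dots> = 1" using m_pos by (simp add: m_def[symmetric])
      finally show "emeasure (density M (\<lambda>x. ennreal (w x / m)))
          (space (density M (\<lambda>x. ennreal (w x / m)))) = 1" by simp
    qed
    then interpret d: prob_space "density M (\<lambda>x. ennreal (w x / m))" .
    have "prob_space (density M' (\<lambda>x. ennreal (w' x / m)))"
    proof
      have "emeasure (density M' (\<lambda>x. ennreal (w' x / m))) (space M') = (\<integral>\<^sup>+x. ennreal (w' x / m) \<partial>M')"
        by (subst emeasure_density) (auto cong: nn_integral_cong_simp)
      also have "\<dots> = ennreal (\<integral>x. w' x / m \<partial>M')"
        using iw' w'_bd m_pos by (intro nn_integral_eq_integral) auto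
      also have "\<dots> = 1" using m_pos by (simp add: m'[symmetric])
      finally show "emeasure (density M' (\<lambda>x. ennreal (w' x / m)))
          (space (density M' (\<lambda>x. ennreal (w' x / m)))) = 1" by simp
    qed
    then interpret d': prob_space "density M' (\<lambda>x. ennreal (w' x / m))" .
    interpret \<mu>: real_distribution \<mu>
      unfolding \<mu>_def by (rule d.real_distribution_distr) simp
    interpret \<mu>': real_distribution \<mu>'
      unfolding \<mu>'_def by (rule d'.real_distribution_distr) simp
    \<comment> \<open>The sine is written as a cosine with phase \<open>- pi / 2\<close>, the only
      kind of test function that \<open>eq\<close> covers.\<close>
    have iexp: "iexp (t * y) = complex_of_real (cos (t * y)) + \<i> * complex_of_real (cos (t * y - pi / 2))" for t y
      by (simp add: complex_eq_iff cos_diff Re_exp Im_exp)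
    have "char \<mu> t = char \<mu>' t" for t
    proof -
      have cint: "complex_integrable M (\<lambda>x. complex_of_real (w x * cos (f x)))"
        if [measurable]: "f \<in> borel_measurable M" for f
        by (intro integrable_of_real int) auto
      have cint': "complex_integrable M' (\<lambda>x. complex_of_real (w' x * cos (f x)))"
        if [measurable]: "f \<in> borel_measurable M'" for f
        by (intro integrable_of_real int') auto
      have "char \<mu> t = (\<integral>x. complex_of_real (w x * cos (t * X x)) / m
          + \<i> * complex_of_real (w x * cos (t * X x + (- pi / 2))) / m \<partial>M)"
        unfolding char_def iexp
        by (subst LINT_\<mu>) (auto simp: scaleR_conv_of_real algebra_simps intro!: Bochner_Integration.integral_cong)
      also have "\<dots> = complex_of_real (\<integral>x. w x * cos (t * X x) \<partial>M) / m
          + \<i> * complex_of_real (\<integral>x. w x * cos (t * X x + (- pi / 2)) \<partial>M) / m"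
        by (subst Bochner_Integration.integral_add)
           (auto intro!: cint integrable_divide_zero integrable_mult_right simp del: of_real_mult simp flip: integral_complex_of_real)
      also have "\<dots> = complex_of_real (\<integral>x. w' x * cos (t * X' x) \<partial>M') / m
          + \<i> * complex_of_real (\<integral>x. w' x * cos (t * X' x + (- pi / 2)) \<partial>M') / m"
        using eq[of t 0] eq[of t "- pi / 2"] by simp
      also have "\<dots> = (\<integral>x. complex_of_real (w' x * cos (t * X' x)) / m
          + \<i> * complex_of_real (w' x * cos (t * X' x + (- pi / 2))) / m \<partial>M')"
        by (subst Bochner_Integration.integral_add)
           (auto intro!: cint' integrable_divide_zero integrable_mult_right simp del: of_real_mult simp flip: integral_complex_of_real)
      also have "\<dots> = char \<mu>' t"
        unfolding char_def iexp
        by (subst LINT_\<mu>') (auto simp: scaleR_conv_of_real algebra_simps intro!: Bochner_Integration.integral_cong)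
      finally show ?thesis .
    qed
    then have "\<mu> = \<mu>'"
      by (intro Levy_uniqueness \<mu>.real_distribution_axioms \<mu>'.real_distribution_axioms) auto
    then have "(\<integral>x. indicat_real B x \<partial>\<mu>) = (\<integral>x. indicat_real B x \<partial>\<mu>')" by simp
    then have "(\<integral>x. w x * indicator B (X x) / m \<partial>M) = (\<integral>x. w' x * indicator B (X' x) / m \<partial>M')"
      by (subst (asm) LINT_\<mu>, simp, subst (asm) LINT_\<mu>') simp_all
    then show ?thesis using m_pos by simp
  qed
qed

text \<open>
  Coordinates are converted one at a time from cosine test functions to indicators of Borel sets.
  The weight \<open>1 + cos (L x + s)\<close> is nonnegative, so it turns the law of one coordinate into a positive
  measure to which Levy's uniqueness theorem applies, and products of cosines reduce to cosines.
\<close>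

proposition PiM_measure_eqI_cos_transform:
  fixes M M' :: "(nat \<Rightarrow> real) measure"
  assumes M: "prob_space M" and M': "prob_space M'"
    and sets: "sets M = sets (PiM {..<d} (\<lambda>_. borel))" "sets M' = sets (PiM {..<d} (\<lambda>_. borel))"
    and eq: "\<And>c s. (\<integral>x. cos ((\<Sum>k<d. c k * x k) + s) \<partial>M) = (\<integral>x. cos ((\<Sum>k<d. c k * x k) + s) \<partial>M')"
  shows "M = M'"
proof -
  interpret M: prob_space M by fact
  interpret M': prob_space M' by fact
  note [measurable_cong] = sets
  define P where "P m B x = (\<Prod>k<m. indicat_real (B k) (x k))" for m :: nat and B and x :: "nat \<Rightarrow> real"
  have P_bd: "0 \<le> P m B x \<and> P m B x \<le> 1" for m B x
    unfolding P_def by (auto intro!: prod_nonneg prod_le_1)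
  have P_meas: "P m B \<in> borel_measurable (PiM {..<d} (\<lambda>_. borel))"
    if "m \<le> d" "\<And>k. B k \<in> sets borel" for m B
    unfolding P_def
  proof (intro borel_measurable_prod)
    fix k assume "k \<in> {..<m}"
    then have [measurable]: "(\<lambda>x. x k) \<in> borel_measurable (PiM {..<d} (\<lambda>_. borel))"
      using that by (intro measurable_component_singleton) auto
    have [measurable]: "B k \<in> sets borel" by fact
    show "(\<lambda>x. indicat_real (B k) (x k)) \<in> borel_measurable (PiM {..<d} (\<lambda>_. borel))" by measurable
  qed
  have lin_meas [measurable]: "(\<lambda>x. \<Sum>k<d. c k * x k) \<in> borel_measurable (PiM {..<d} (\<lambda>_. borel))" for c :: "nat \<Rightarrow> real"
    by measurable
  have one_plus_cos: "0 \<le> 1 + cos y" for y :: real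
    using cos_ge_minus_one[of y] by linarith
  have bd: "\<bar>P m B x * cos y\<bar> \<le> 1" for m B x y
    using mult_mono[of "P m B x" 1 "\<bar>cos y\<bar>" 1] P_bd[of m B x] by (auto simp: abs_mult)
  \<comment> \<open>Induction on the number \<open>m\<close> of coordinates already tested by
    indicators. The frequencies \<open>c\<close> and the phase \<open>s\<close> stay arbitrary,
    since converting the next coordinate changes both.\<close>
  have main: "(\<integral>x. P m B x * cos ((\<Sum>k<d. c k * x k) + s) \<partial>M)
      = (\<integral>x. P m B x * cos ((\<Sum>k<d. c k * x k) + s) \<partial>M')"
    if "m \<le> d" "\<And>k. B k \<in> sets borel" for m B c s
    using that
  proof (induction m arbitrary: c s)
    case 0
    then show ?case by (simp add: P_def eq)
  next
    case (Suc m)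
    have [measurable]: "P m B \<in> borel_measurable (PiM {..<d} (\<lambda>_. borel))" "\<And>k. B k \<in> sets borel"
      using Suc.prems P_meas by auto
    have [measurable]: "(\<lambda>x. x m) \<in> borel_measurable (PiM {..<d} (\<lambda>_. borel))"
      using Suc.prems by (intro measurable_component_singleton) auto
    have intM: "integrable M (\<lambda>x. P m B x * cos ((\<Sum>k<d. c k * x k) + s))" for c s
      by (rule M.integrable_const_bound[where B=1]) (use bd in \<open>auto\<close>)
    have intM': "integrable M' (\<lambda>x. P m B x * cos ((\<Sum>k<d. c k * x k) + s))" for c s
      by (rule M'.integrable_const_bound[where B=1]) (use bd in \<open>auto\<close>)
    have upd: "(\<Sum>k<d. (c(m := c m + t)) k * x k) = (\<Sum>k<d. c k * x k) + t * x m" for c t and x :: "nat \<Rightarrow> real"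
    proof -
      have "(\<Sum>k<d. (c(m := c m + t)) k * x k) = (\<Sum>k<d. c k * x k + (if k = m then t * x m else 0))"
        by (intro sum.cong) (auto simp: algebra_simps)
      also have "\<dots> = (\<Sum>k<d. c k * x k) + t * x m"
        using Suc.prems by (simp add: sum.distrib)
      finally show ?thesis .
    qed
    have step: "(\<integral>x. P m B x * (1 + cos ((\<Sum>k<d. c k * x k) + s)) * indicator (B m) (x m) \<partial>M)
      = (\<integral>x. P m B x * (1 + cos ((\<Sum>k<d. c k * x k) + s)) * indicator (B m) (x m) \<partial>M')" for c s
    proof (rule integral_indicator_eq_of_cos_transform[OF M M', where C = 2])
      show "0 \<le> P m B x * (1 + cos ((\<Sum>k<d. c k * x k) + s)) \<and>
         P m B x * (1 + cos ((\<Sum>k<d. c k * x k) + s)) \<le> 2" for x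
        using mult_mono[of "P m B x" 1 "1 + cos ((\<Sum>k<d. c k * x k) + s)" 2] P_bd[of m B x]
          one_plus_cos[of "(\<Sum>k<d. c k * x k) + s"]
        by (auto intro!: mult_nonneg_nonneg)
      then show "0 \<le> P m B x * (1 + cos ((\<Sum>k<d. c k * x k) + s)) \<and>
         P m B x * (1 + cos ((\<Sum>k<d. c k * x k) + s)) \<le> 2" for x .
      fix t r :: real
      let ?e = "(\<lambda>_. 0)(m := 0 + t)"
      \<comment> \<open>Product-to-sum formula: the extra cosine only moves the frequency of
        coordinate \<open>m\<close> by \<open>t\<close> or \<open>- t\<close> and the phase by
        \<open>r\<close> or \<open>- r\<close>, so the induction hypothesis applies to every
        summand.\<close>
      have expand: "P m B x * (1 + cos ((\<Sum>k<d. c k * x k) + s)) * cos (t * x m + r)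
         = P m B x * cos ((\<Sum>k<d. ?e k * x k) + r)
          + (P m B x * cos ((\<Sum>k<d. (c(m := c m + t)) k * x k) + (s + r)) / 2
          + P m B x * cos ((\<Sum>k<d. (c(m := c m + - t)) k * x k) + (s - r)) / 2)" for x
      proof -
        have "cos ((\<Sum>k<d. c k * x k) + s) * cos (t * x m + r) =
          (cos ((\<Sum>k<d. c k * x k) + t * x m + (s + r)) + cos ((\<Sum>k<d. c k * x k) + - t * x m + (s - r))) / 2"
        proof -
          have "(\<Sum>k<d. c k * x k) + t * x m + (s + r) = ((\<Sum>k<d. c k * x k) + s) + (t * x m + r)"
            "(\<Sum>k<d. c k * x k) + - t * x m + (s - r) = ((\<Sum>k<d. c k * x k) + s) - (t * x m + r)"
            by simp_all
          then show ?thesis by (simp only: cos_times_cos add.commute)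
        qed
        then show ?thesis
          unfolding upd upd[of "\<lambda>_. 0" t x] by (simp add: algebra_simps add_divide_distrib)
      qed
      show "(\<integral>x. P m B x * (1 + cos ((\<Sum>k<d. c k * x k) + s)) * cos (t * x m + r) \<partial>M) =
         (\<integral>x. P m B x * (1 + cos ((\<Sum>k<d. c k * x k) + s)) * cos (t * x m + r) \<partial>M')"
        unfolding expand using Suc
        by (simp add: intM intM' del: fun_upd_apply)
    qed measurable
    \<comment> \<open>The constant 1 in the weight is removed by subtracting the same integrand with
      zero frequencies and phase \<open>pi / 2\<close>, where the cosine vanishes.\<close>
    have split: "P (Suc m) B x * cos ((\<Sum>k<d. c k * x k) + s) =
        P m B x * (1 + cos ((\<Sum>k<d. c k * x k) + s)) * indicator (B m) (x m)
        - P m B x * (1 + cos ((\<Sum>k<d. 0 * x k) + pi / 2)) * indicator (B m) (x m)" for x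
      by (simp add: P_def algebra_simps)
    have i: "integrable N (\<lambda>x. P m B x * (1 + cos ((\<Sum>k<d. c k * x k) + s)) * indicator (B m) (x m))"
      if "prob_space N" and [measurable_cong]: "sets N = sets (PiM {..<d} (\<lambda>_. borel))" for N c s
    proof -
      interpret N: prob_space N by fact
      have "\<bar>P m B x * (1 + cos y) * indicator (B m) z\<bar> \<le> 2" for x y z
        using mult_mono[of "P m B x" 1 "1 + cos y" 2] P_bd[of m B x] one_plus_cos[of y]
        by (auto simp: abs_mult indicator_def)
      then show ?thesis
        by (intro N.integrable_const_bound[where B=2]) auto
    qed
    show ?case
      unfolding split
      by (simp only: Bochner_Integration.integral_diff[OF i[OF M sets(1)] i[OF M sets(1)]]
          Bochner_Integration.integral_diff[OF i[OF M' sets(2)] i[OF M' sets(2)]] step)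
  qed
  show ?thesis
  proof (rule measure_eqI_PiM_finite[where I = "{..<d}" and M = "\<lambda>_. borel" and A = "\<lambda>i::nat. {..<d} \<rightarrow>\<^sub>E UNIV"])
    fix B :: "nat \<Rightarrow> real set" assume B: "\<And>i. i \<in> {..<d} \<Longrightarrow> B i \<in> sets borel"
    \<comment> \<open>\<open>main\<close> asks for Borel sets at every index, whereas
      \<open>B\<close> is controlled only below \<open>d\<close>. The default value is harmless,
      because \<open>P d\<close> looks only at indices below \<open>d\<close>.\<close>
    define B' where "B' k = (if k < d then B k else {})" for k
    have [measurable]: "B' k \<in> sets borel" for k using B by (auto simp: B'_def)
    have *: "emeasure N (PiE {..<d} B) = ennreal (\<integral>x. P d B' x * cos ((\<Sum>k<d. 0 * x k) + 0) \<partial>N)"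
      if "prob_space N" and s: "sets N = sets (PiM {..<d} (\<lambda>_. borel))" for N
    proof -
      interpret N: prob_space N by fact
      have sp: "space N = PiE {..<d} (\<lambda>_. UNIV)" using sets_eq_imp_space_eq[OF s] by (simp add: space_PiM)
      have "(\<integral>x. P d B' x * cos ((\<Sum>k<d. 0 * x k) + 0) \<partial>N) = (\<integral>x. indicator (PiE {..<d} B) x \<partial>N)"
      proof (intro Bochner_Integration.integral_cong refl)
        fix x assume "x \<in> space N"
        then have "x \<in> PiE {..<d} B \<longleftrightarrow> (\<forall>k<d. x k \<in> B' k)" by (auto simp: sp B'_def PiE_iff)
        then show "P d B' x * cos ((\<Sum>k<d. 0 * x k) + 0) = indicator (PiE {..<d} B) x"
          by (auto simp: P_def indicator_def intro!: prod.neutral)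
      qed
      also have "\<dots> = measure N (PiE {..<d} B)"
        using B by (subst Bochner_Integration.integral_indicator) (auto simp: s N.emeasure_eq_measure intro!: sets_PiM_I_finite)
      finally show ?thesis by (simp add: N.emeasure_eq_measure)
    qed
    show "emeasure M (PiE {..<d} B) = emeasure M' (PiE {..<d} B)"
      using main[of d B' "\<lambda>_. 0" 0] *[OF M sets(1)] *[OF M' sets(2)] by simp
  qed (use sets in \<open>auto simp: space_PiM intro!: prod_algebraI_finite\<close>)
qed

section \<open>Linear images of standard Gaussian vectors\<close>

lemma real_distribution_std_gauss: "real_distribution std_gauss"
  unfolding std_gauss_def by (rule real_dist_normal_dist)

interpretation std_gauss: real_distribution std_gauss
  by (rule real_distribution_std_gauss)

interpretation std_gauss_product: product_sigma_finite "\<lambda>_::nat. std_gauss"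
  by (simp add: product_sigma_finite_def std_gauss.sigma_finite_measure_axioms)

lemma prob_space_gaussN: "prob_space (gaussN d)"
  unfolding gaussN_def by (rule prob_space_PiM) (rule std_gauss.prob_space_axioms)

interpretation gaussN: prob_space "gaussN d" for d
  by (rule prob_space_gaussN)

lemma sets_gaussN [measurable_cong]: "sets (gaussN d) = sets (PiM {..<d} (\<lambda>_. borel))"
  unfolding gaussN_def by (rule sets_PiM_cong) auto

lemma space_gaussN: "space (gaussN d) = PiE {..<d} (\<lambda>_. UNIV)"
  using sets_eq_imp_space_eq[OF sets_gaussN] by (simp add: space_PiM)

lemma measurable_gaussN_component: "k < d \<Longrightarrow> (\<lambda>n. n k) \<in> borel_measurable (gaussN d)"
  unfolding measurable_cong_sets[OF sets_gaussN refl]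
  by (rule measurable_component_singleton) auto

lemma measurable_gaussN_linear [measurable]:
  "(\<lambda>n. \<Sum>k<d. c k * n k) \<in> borel_measurable (gaussN d)"
  by (intro borel_measurable_sum borel_measurable_times borel_measurable_const measurable_gaussN_component) auto

text \<open>Independence factorises the transform into one-dimensional standard normal
  characteristic functions.\<close>

lemma integral_gaussN_iexp:
  "(\<integral>n. iexp (\<Sum>k<d. c k * n k) \<partial>gaussN d) = exp (- (\<Sum>k<d. (c k)\<^sup>2) / 2)"
proof -
  have "iexp (\<Sum>k<d. c k * n k) = (\<Prod>k<d. iexp (c k * n k))" for n
    by (simp add: exp_sum[symmetric] sum_distrib_left)
  then have "(\<integral>n. iexp (\<Sum>k<d. c k * n k) \<partial>gaussN d) = (\<integral>n. (\<Prod>k<d. iexp (c k * n k)) \<partial>gaussN d)"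
    by simp
  also have "\<dots> = (\<Prod>k<d. \<integral>x. iexp (c k * x) \<partial>std_gauss)"
    unfolding gaussN_def
    by (rule std_gauss_product.product_integral_prod) (auto intro!: std_gauss.integrable_iexp)
  also have "\<dots> = (\<Prod>k<d. char std_gauss (c k))"
    by (simp add: char_def)
  also have "\<dots> = (\<Prod>k<d. complex_of_real (exp (- (c k)\<^sup>2 / 2)))"
    by (simp add: std_gauss_def char_std_normal_distribution)
  also have "\<dots> = exp (- (\<Sum>k<d. (c k)\<^sup>2) / 2)"
    by (simp add: exp_sum[symmetric] sum_negf[symmetric] sum_divide_distrib flip: of_real_prod)
  finally show ?thesis .
qed

lemma integral_gaussN_cos:
  "(\<integral>n. cos ((\<Sum>k<d. c k * n k) + s) \<partial>gaussN d) = cos s * exp (- (\<Sum>k<d. (c k)\<^sup>2) / 2)"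
proof -
  have int: "complex_integrable (gaussN d) (\<lambda>n. cis s * iexp (\<Sum>k<d. c k * n k))"
    by (intro integrable_mult_right gaussN.integrable_const_bound[where B=1]) auto
  have "(\<integral>n. cos ((\<Sum>k<d. c k * n k) + s) \<partial>gaussN d) = (\<integral>n. Re (cis s * iexp (\<Sum>k<d. c k * n k)) \<partial>gaussN d)"
    by (simp add: cos_add Re_exp Im_exp algebra_simps)
  also have "\<dots> = Re (\<integral>n. cis s * iexp (\<Sum>k<d. c k * n k) \<partial>gaussN d)"
    by (rule integral_Re) (rule int)
  also have "\<dots> = Re (cis s * exp (- (\<Sum>k<d. (c k)\<^sup>2) / 2))"
    by (simp only: integral_mult_right_zero integral_gaussN_iexp)
  finally show ?thesis by simp
qed

text \<open>The variance of a combination of the \<open>Y_i\<close> is the quadratic form of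
  \<open>A A^T\<close>. Laws therefore depend on \<open>A\<close> only through \<open>A A^T\<close>,
  and positive definiteness yields positive variances.\<close>

lemma sum_square_linear_comb:
  fixes A :: "nat \<Rightarrow> nat \<Rightarrow> real"
  shows "(\<Sum>l<d. (\<Sum>i<m. c i * A i l)\<^sup>2) = (\<Sum>i<m. \<Sum>k<m. c i * (\<Sum>l<d. A i l * A k l) * c k)"
proof -
  have "(\<Sum>l<d. (\<Sum>i<m. c i * A i l)\<^sup>2) = (\<Sum>l<d. \<Sum>i<m. \<Sum>k<m. c i * A i l * (c k * A k l))"
    by (simp add: power2_eq_square sum_product)
  also have "\<dots> = (\<Sum>i<m. \<Sum>k<m. \<Sum>l<d. c i * A i l * (c k * A k l))"
    by (subst sum.swap) (intro sum.cong refl sum.swap)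
  also have "\<dots> = (\<Sum>i<m. \<Sum>k<m. c i * (\<Sum>l<d. A i l * A k l) * c k)"
    by (simp add: sum_distrib_left sum_distrib_right mult_ac)
  finally show ?thesis .
qed

lemma sum_Yv: "(\<Sum>i<m. c i * Yv d A n i) = (\<Sum>l<d. (\<Sum>i<m. c i * A i l) * n l)"
  unfolding Yv_def by (simp add: sum_distrib_left sum_distrib_right mult_ac) (rule sum.swap)

lemma measurable_Yv [measurable]: "(\<lambda>n. Yv d A n i) \<in> borel_measurable (gaussN d)"
  unfolding Yv_def by measurable

text \<open>The cosine transform of \<open>A N\<close> contains only the quadratic form of
  \<open>A A^T\<close>. Different factors of one correlation matrix can thus be exchanged.\<close>

proposition distr_Yv_eqI:
  assumes "\<And>i k. i < m \<Longrightarrow> k < m \<Longrightarrow> (\<Sum>l<d. A i l * A k l) = (\<Sum>l<d. B i l * B k l)"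
  shows "distr (gaussN d) (PiM {..<m} (\<lambda>_. borel)) (\<lambda>n. \<lambda>i\<in>{..<m}. Yv d A n i) =
         distr (gaussN d) (PiM {..<m} (\<lambda>_. borel)) (\<lambda>n. \<lambda>i\<in>{..<m}. Yv d B n i)"
proof (rule PiM_measure_eqI_cos_transform)
  fix c s
  have *: "(\<integral>x. cos ((\<Sum>k<m. c k * x k) + s) \<partial>distr (gaussN d) (PiM {..<m} (\<lambda>_. borel)) (\<lambda>n. \<lambda>i\<in>{..<m}. Yv d A n i))
      = cos s * exp (- (\<Sum>i<m. \<Sum>k<m. c i * (\<Sum>l<d. A i l * A k l) * c k) / 2)" for A
    by (subst integral_distr) (auto simp: sum_Yv integral_gaussN_cos sum_square_linear_comb)
  show "(\<integral>x. cos ((\<Sum>k<m. c k * x k) + s) \<partial>distr (gaussN d) (PiM {..<m} (\<lambda>_. borel)) (\<lambda>n. \<lambda>i\<in>{..<m}. Yv d A n i))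
      = (\<integral>x. cos ((\<Sum>k<m. c k * x k) + s) \<partial>distr (gaussN d) (PiM {..<m} (\<lambda>_. borel)) (\<lambda>n. \<lambda>i\<in>{..<m}. Yv d B n i))"
    unfolding * using assms by simp
qed (auto intro!: gaussN.prob_space_distr)

text \<open>Both sides have characteristic function \<open>exp (- t^2 * v / 2)\<close>, where
  \<open>v\<close> is the sum of the squared coefficients. Writing the law as an image rather than
  by a density includes the degenerate case \<open>v = 0\<close>.\<close>

lemma distr_gaussN_linear:
  "distr (gaussN d) borel (\<lambda>n. \<Sum>k<d. c k * n k)
    = distr std_gauss borel (\<lambda>x. sqrt (\<Sum>k<d. (c k)\<^sup>2) * x)"
proof (rule Levy_uniqueness)
  show "char (distr (gaussN d) borel (\<lambda>n. \<Sum>k<d. c k * n k))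
     = char (distr std_gauss borel (\<lambda>x. sqrt (\<Sum>k<d. (c k)\<^sup>2) * x))"
  proof
    fix t
    have "char (distr (gaussN d) borel (\<lambda>n. \<Sum>k<d. c k * n k)) t
        = (\<integral>n. iexp (\<Sum>k<d. t * c k * n k) \<partial>gaussN d)"
      unfolding char_def by (subst integral_distr) (auto simp: sum_distrib_left mult_ac)
    also have "\<dots> = exp (- (t\<^sup>2 * (\<Sum>k<d. (c k)\<^sup>2)) / 2)"
      by (simp only: integral_gaussN_iexp power_mult_distrib sum_distrib_left)
    also have "\<dots> = char std_gauss (t * sqrt (\<Sum>k<d. (c k)\<^sup>2))"
      by (simp add: std_gauss_def char_std_normal_distribution power_mult_distrib sum_nonneg)
    also have "\<dots> = char (distr std_gauss borel (\<lambda>x. sqrt (\<Sum>k<d. (c k)\<^sup>2) * x)) t"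
      unfolding char_def by (subst integral_distr) (auto simp: mult_ac)
    finally show "char (distr (gaussN d) borel (\<lambda>n. \<Sum>k<d. c k * n k)) t
      = char (distr std_gauss borel (\<lambda>x. sqrt (\<Sum>k<d. (c k)\<^sup>2) * x)) t" .
  qed
qed (auto intro!: gaussN.real_distribution_distr std_gauss.real_distribution_distr)

lemma measure_gaussN_linear:
  assumes [measurable]: "S \<in> sets borel"
  shows "measure (gaussN d) {n \<in> space (gaussN d). (\<Sum>k<d. c k * n k) \<in> S}
      = measure std_gauss {x. sqrt (\<Sum>k<d. (c k)\<^sup>2) * x \<in> S}"
proof -
  have "measure (gaussN d) {n \<in> space (gaussN d). (\<Sum>k<d. c k * n k) \<in> S}
     = measure (distr (gaussN d) borel (\<lambda>n. \<Sum>k<d. c k * n k)) S"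
    by (subst measure_distr) (auto intro!: arg_cong[where f="measure (gaussN d)"])
  also have "\<dots> = measure std_gauss {x. sqrt (\<Sum>k<d. (c k)\<^sup>2) * x \<in> S}"
    unfolding distr_gaussN_linear
    by (subst measure_distr) (auto intro!: arg_cong[where f="measure std_gauss"])
  finally show ?thesis .
qed

lemma std_gauss_singleton: "measure std_gauss {a} = 0"
proof -
  have "emeasure std_gauss {a} = 0"
    unfolding std_gauss_def by (subst emeasure_density) (auto simp: nn_integral_0_iff_AE AE_lborel_singleton intro: AE_mp[OF AE_lborel_singleton[of a]])
  then show ?thesis by (simp add: measure_def)
qed

text \<open>For a standard Gaussian variable the event shrinks to a single point. This excludes ties
  between two of the \<open>X_i\<close> later.\<close>

lemma measure_gaussN_hyperplane:
  assumes "(\<Sum>k<d. (c k)\<^sup>2) > 0"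
  shows "measure (gaussN d) {n \<in> space (gaussN d). (\<Sum>k<d. c k * n k) = b} = 0"
proof -
  have "{x. sqrt (\<Sum>k<d. (c k)\<^sup>2) * x = b} = {b / sqrt (\<Sum>k<d. (c k)\<^sup>2)}"
    using assms by (auto simp: field_simps)
  then show ?thesis
    using measure_gaussN_linear[of "{b}" d c] by (simp add: std_gauss_singleton)
qed

text \<open>The threshold is measured in standard deviations. Only an inequality is claimed, because
  for zero variance the event on the left is empty.\<close>

lemma measure_gaussN_linear_tail:
  assumes "r \<ge> 0"
  shows "measure (gaussN d) {n \<in> space (gaussN d). (\<Sum>k<d. c k * n k) > r * sqrt (\<Sum>k<d. (c k)\<^sup>2)}
     \<le> measure std_gauss {r<..}"
proof -
  let ?q = "sqrt (\<Sum>k<d. (c k)\<^sup>2)"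
  have "measure (gaussN d) {n \<in> space (gaussN d). (\<Sum>k<d. c k * n k) > r * ?q}
     = measure std_gauss {x. ?q * x > r * ?q}"
    using measure_gaussN_linear[of "{r * ?q <..}" d c] by simp
  also have "\<dots> \<le> measure std_gauss {r<..}"
  proof (rule std_gauss.finite_measure_mono)
    have "?q \<ge> 0" by (intro real_sqrt_ge_zero sum_nonneg) auto
    then show "{x. ?q * x > r * ?q} \<subseteq> {r<..}"
      by (auto simp: mult.commute[of r] mult_less_cancel_left)
  qed auto
  finally show ?thesis .
qed

section \<open>Integrating out one coordinate of the Gaussian vector\<close>

lemma measurable_nn_integral_resample:
  assumes [measurable]: "f \<in> borel_measurable (gaussN d)" and j: "j < d"
  shows "(\<lambda>n. \<integral>\<^sup>+t. f (n(j := t)) \<partial>std_gauss) \<in> borel_measurable (gaussN d)"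
proof -
  have "(\<lambda>p. (fst p)(j := snd p)) \<in> gaussN d \<Otimes>\<^sub>M std_gauss \<rightarrow>\<^sub>M PiM (insert j {..<d}) (\<lambda>_. std_gauss)"
    by (rule measurable_fun_upd[where J = "{..<d}"]) (auto simp: gaussN_def)
  then have [measurable]: "(\<lambda>(n, t). n(j := t)) \<in> gaussN d \<Otimes>\<^sub>M std_gauss \<rightarrow>\<^sub>M gaussN d"
    using j by (simp add: gaussN_def insert_absorb case_prod_beta)
  show ?thesis
    by (rule std_gauss.borel_measurable_nn_integral) measurable
qed

text \<open>The inner integral no longer depends on \<open>n j\<close>, so integrating that coordinate once more is harmless.\<close>

lemma nn_integral_gaussN_resample:
  assumes [measurable]: "f \<in> borel_measurable (gaussN d)" and j: "j < d"
  shows "(\<integral>\<^sup>+n. (\<integral>\<^sup>+t. f (n(j := t)) \<partial>std_gauss) \<partial>gaussN d) = (\<integral>\<^sup>+n. f n \<partial>gaussN d)"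
proof -
  have ins: "{..<d} = insert j ({..<d} - {j})" using j by auto
  have unfold: "(\<integral>\<^sup>+n. h n \<partial>gaussN d) =
     (\<integral>\<^sup>+n. (\<integral>\<^sup>+t. h (n(j := t)) \<partial>std_gauss) \<partial>PiM ({..<d} - {j}) (\<lambda>_. std_gauss))"
    if "h \<in> borel_measurable (gaussN d)" for h
    using that unfolding gaussN_def
    by (subst (1) ins, intro std_gauss_product.product_nn_integral_insert) (use j in \<open>auto simp: insert_absorb\<close>)
  have [measurable]: "(\<lambda>n. \<integral>\<^sup>+t. f (n(j := t)) \<partial>std_gauss) \<in> borel_measurable (gaussN d)"
    using assms by (rule measurable_nn_integral_resample)
  show ?thesis
    using std_gauss.emeasure_space_1 by (subst (1 2) unfold) auto
qed

section \<open>Gaussian tails\<close>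

definition gauss_tail :: "real \<Rightarrow> real" where
  "gauss_tail s = measure std_gauss {s<..}"

lemma gauss_tail_mono: "s \<le> t \<Longrightarrow> gauss_tail t \<le> gauss_tail s"
  unfolding gauss_tail_def by (intro std_gauss.finite_measure_mono) auto

lemma gauss_tail_nonneg: "0 \<le> gauss_tail s"
  unfolding gauss_tail_def by simp

lemma DERIV_std_normal_density:
  "(std_normal_density has_real_derivative - x * std_normal_density x) (at x)"
proof -
  have "((\<lambda>x. 1 / sqrt (2 * pi) * exp (- x\<^sup>2 / 2)) has_real_derivative
      1 / sqrt (2 * pi) * (exp (- x\<^sup>2 / 2) * (- x))) (at x)"
    by (rule DERIV_cmult) (auto intro!: derivative_eq_intros)
  moreover have "std_normal_density = (\<lambda>x. 1 / sqrt (2 * pi) * exp (- x\<^sup>2 / 2))"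
    by (simp add: fun_eq_iff std_normal_density_def)
  ultimately show ?thesis by (simp add: mult_ac)
qed

text \<open>The integrand is the derivative of \<open>- \<phi>(x) / x\<close>, and both Mills bounds follow from this single identity.\<close>

lemma nn_integral_mills:
  assumes s: "s > 0"
  shows "(\<integral>\<^sup>+x. ennreal ((1 + 1 / x\<^sup>2) * std_normal_density x) * indicator {s..} x \<partial>lborel)
    = ennreal (std_normal_density s / s)"
proof -
  have "(\<integral>\<^sup>+x. ennreal ((1 + 1 / x\<^sup>2) * std_normal_density x) * indicator {s..} x \<partial>lborel)
     = ennreal (0 - (- std_normal_density s / s))"
  proof (rule nn_integral_FTC_atLeast)
    fix x assume "s \<le> x"
    then have "x > 0" using s by simp
    then show "((\<lambda>x. - std_normal_density x / x) has_real_derivative (1 + 1 / x\<^sup>2) * std_normal_density x) (at x)"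
      by (auto intro!: derivative_eq_intros DERIV_std_normal_density simp: field_simps power2_eq_square)
    show "0 \<le> (1 + 1 / x\<^sup>2) * std_normal_density x"
      by (intro mult_nonneg_nonneg) auto
  next
    show "((\<lambda>x. - std_normal_density x / x) \<longlongrightarrow> 0) at_top"
      unfolding std_normal_density_def by real_asymp
  qed measurable
  then show ?thesis by simp
qed

text \<open>For \<open>x \<ge> s\<close> the factor \<open>1 + 1 / x^2\<close> in
  \<open>nn_integral_mills\<close> lies between 1 and \<open>1 + 1 / s^2\<close>; each of these two
  estimates gives one of the bounds.\<close>

lemma gauss_tail_mills:
  assumes s: "s > 0"
  shows "gauss_tail s \<le> std_normal_density s / s"
    and "std_normal_density s / s \<le> (1 + 1 / s\<^sup>2) * gauss_tail s"
proof -
  have e: "emeasure std_gauss B = (\<integral>\<^sup>+x. ennreal (std_normal_density x) * indicator B x \<partial>lborel)"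
    if "B \<in> sets borel" for B
    unfolding std_gauss_def using that by (subst emeasure_density) auto
  have "ennreal (gauss_tail s) = (\<integral>\<^sup>+x. ennreal (std_normal_density x) * indicator {s<..} x \<partial>lborel)"
    unfolding gauss_tail_def by (simp add: e flip: std_gauss.emeasure_eq_measure)
  also have "\<dots> \<le> (\<integral>\<^sup>+x. ennreal ((1 + 1 / x\<^sup>2) * std_normal_density x) * indicator {s..} x \<partial>lborel)"
    by (intro nn_integral_mono) (auto simp: indicator_def ennreal_leI algebra_simps)
  finally show "gauss_tail s \<le> std_normal_density s / s"
    unfolding nn_integral_mills[OF s] using s by (subst (asm) ennreal_le_iff) auto
  have "ennreal (std_normal_density s / s)
      \<le> (\<integral>\<^sup>+x. ennreal (1 + 1 / s\<^sup>2) * (ennreal (std_normal_density x) * indicator {s..} x) \<partial>lborel)"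
    unfolding nn_integral_mills[OF s, symmetric]
  proof (intro nn_integral_mono)
    fix x
    have "(1 + 1 / x\<^sup>2) * std_normal_density x \<le> (1 + 1 / s\<^sup>2) * std_normal_density x" if "s \<le> x"
      using that s by (intro mult_right_mono add_mono divide_left_mono power_mono) auto
    then show "ennreal ((1 + 1 / x\<^sup>2) * std_normal_density x) * indicator {s..} x
       \<le> ennreal (1 + 1 / s\<^sup>2) * (ennreal (std_normal_density x) * indicator {s..} x)"
      by (auto simp: indicator_def ennreal_leI ennreal_mult[symmetric] simp del: ennreal_plus)
  qed
  also have "\<dots> = ennreal (1 + 1 / s\<^sup>2) * emeasure std_gauss {s..}"
    by (subst nn_integral_cmult) (auto simp: e)
  also have "\<dots> = ennreal ((1 + 1 / s\<^sup>2) * measure std_gauss {s..})"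
    by (subst ennreal_mult) (auto simp: std_gauss.emeasure_eq_measure)
  also have "measure std_gauss {s..} = gauss_tail s"
  proof -
    have "{s..} = {s<..} \<union> {s}" by auto
    then show ?thesis
      unfolding gauss_tail_def using std_gauss.finite_measure_Union[of "{s<..}" "{s}"]
      by (simp add: std_gauss_singleton)
  qed
  finally show "std_normal_density s / s \<le> (1 + 1 / s\<^sup>2) * gauss_tail s"
    by (subst (asm) ennreal_le_iff) (auto intro!: mult_nonneg_nonneg gauss_tail_nonneg)
qed

lemma gauss_tail_pos: "0 < gauss_tail s"
proof -
  define t where "t = max s 1"
  have "0 < t" by (simp add: t_def)
  then have "0 < std_normal_density t / t" by (intro divide_pos_pos normal_density_pos) auto
  also have "\<dots> \<le> (1 + 1 / t\<^sup>2) * gauss_tail t"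
    by (rule gauss_tail_mills) fact
  finally have "0 < gauss_tail t"
    using gauss_tail_nonneg[of t] by (cases "gauss_tail t = 0") auto
  also have "\<dots> \<le> gauss_tail s" by (rule gauss_tail_mono) (simp add: t_def)
  finally show ?thesis .
qed

section \<open>Crude tail estimates and comparison of tails at different levels\<close>

lemma gauss_tail_le_density: "1 \<le> s \<Longrightarrow> gauss_tail s \<le> std_normal_density s"
  using gauss_tail_mills(1)[of s] divide_left_mono[of 1 s "std_normal_density s"] by simp

lemma gauss_tail_le_exp:
  assumes "1 \<le> s"
  shows "gauss_tail s \<le> exp (- s\<^sup>2 / 2)"
proof -
  have "1 \<le> sqrt (2 * pi)" using pi_gt3 by simp
  then have "std_normal_density s \<le> exp (- s\<^sup>2 / 2)"
    unfolding std_normal_density_def by (simp add: field_simps)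
  then show ?thesis using gauss_tail_le_density[OF assms] by simp
qed

text \<open>The factor \<open>s\<close> from Mills' lower bound is weakened to \<open>exp s\<close>,
  so that it enters the exponents of later estimates as a term linear in \<open>s\<close>.\<close>

lemma gauss_tail_ge_density:
  assumes s: "1 \<le> s"
  shows "std_normal_density s \<le> 2 * exp s * gauss_tail s"
proof -
  have "1 + 1 / s\<^sup>2 \<le> 2" using one_le_power[of s 2] s by (simp add: field_simps)
  then have "std_normal_density s / s \<le> 2 * gauss_tail s"
    using gauss_tail_mills(2)[of s] s gauss_tail_nonneg[of s]
    by (meson mult_right_mono order_trans less_le_trans zero_less_one)
  then have "std_normal_density s \<le> s * (2 * gauss_tail s)" using s by (simp add: field_simps)
  also have "s \<le> exp s" using exp_ge_add_one_self[of s] by linarith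
  then have "s * (2 * gauss_tail s) \<le> exp s * (2 * gauss_tail s)"
    using gauss_tail_nonneg[of s] by (intro mult_right_mono) auto
  finally show ?thesis by (simp add: mult_ac)
qed

text \<open>The density ratio between \<open>s - h\<close> and \<open>s\<close> is
  \<open>exp (s * h - h^2 / 2)\<close>, which tends to \<open>exp \<kappa>\<close> because
  \<open>h\<close> itself tends to 0. The two Mills bounds differ by factors tending to 1.\<close>

lemma gauss_tail_shift_eventually:
  fixes s h :: "'a \<Rightarrow> real"
  assumes s: "filterlim s at_top F" and sh: "((\<lambda>u. s u * h u) \<longlongrightarrow> \<kappa>) F" and q: "q > exp \<kappa>"
  shows "eventually (\<lambda>u. gauss_tail (s u - h u) \<le> q * gauss_tail (s u)) F"
proof -
  have i: "((\<lambda>u. 1 / s u) \<longlongrightarrow> 0) F"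
    using tendsto_inverse_0_at_top[OF s] by (simp add: divide_inverse)
  have s_pos: "eventually (\<lambda>u. s u > 0) F"
    using filterlim_at_top_dense s by blast
  have h0: "(h \<longlongrightarrow> 0) F"
  proof (rule Lim_transform_eventually)
    show "((\<lambda>u. s u * h u * (1 / s u)) \<longlongrightarrow> 0) F"
      using tendsto_mult[OF sh i] by simp
    show "eventually (\<lambda>u. s u * h u * (1 / s u) = h u) F"
      using s_pos by eventually_elim auto
  qed
  \<comment> \<open>\<open>?B\<close> is the density ratio times the quotient of the Mills factors,
    written in \<open>h\<close> and \<open>1 / s\<close> so that its limit can be read off.\<close>
  let ?B = "\<lambda>u. exp (s u * h u - (h u)\<^sup>2 / 2) * ((1 + (1 / s u)\<^sup>2) / (1 - h u * (1 / s u)))"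
  have "(?B \<longlongrightarrow> exp (\<kappa> - 0\<^sup>2 / 2) * ((1 + 0\<^sup>2) / (1 - 0 * 0))) F"
    by (intro tendsto_intros sh h0 i) auto
  then have "eventually (\<lambda>u. ?B u < q) F"
    using q by (intro order_tendstoD(2)) auto
  moreover have "eventually (\<lambda>u. h u < 1) F"
    using h0 by (rule order_tendstoD(2)) simp
  moreover have "eventually (\<lambda>u. s u > 1) F"
    using filterlim_at_top_dense s by blast
  ultimately show ?thesis
  proof eventually_elim
    case (elim u)
    have a: "s u - h u > 0" "s u > 0" using elim by auto
    have "gauss_tail (s u - h u) \<le> std_normal_density (s u - h u) / (s u - h u)"
      using a by (intro gauss_tail_mills) auto
    also have "std_normal_density (s u - h u) = exp (s u * h u - (h u)\<^sup>2 / 2) * std_normal_density (s u)"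
      unfolding std_normal_density_def
      by (simp add: exp_add[symmetric] power2_diff field_simps)
    also have "exp (s u * h u - (h u)\<^sup>2 / 2) * std_normal_density (s u) / (s u - h u)
        = exp (s u * h u - (h u)\<^sup>2 / 2) * (s u / (s u - h u)) * (std_normal_density (s u) / s u)"
      using a by (simp add: field_simps)
    also have "\<dots> \<le> exp (s u * h u - (h u)\<^sup>2 / 2) * (s u / (s u - h u)) * ((1 + 1 / (s u)\<^sup>2) * gauss_tail (s u))"
      using a by (intro mult_left_mono gauss_tail_mills) auto
    also have "\<dots> = ?B u * gauss_tail (s u)"
      using a by (simp add: field_simps power2_eq_square)
    also have "\<dots> \<le> q * gauss_tail (s u)"
      using elim gauss_tail_nonneg by (intro mult_right_mono) auto
    finally show ?case .
  qed
qed

text \<open>\<open>R\<close> is the order of magnitude of the exponent: \<open>L\<close> in the next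
  lemma and \<open>L^2\<close> in the one after it.\<close>

lemma exp_tendsto_0_if_neg_rate:
  fixes E R :: "'a \<Rightarrow> real"
  assumes R: "filterlim R at_top F" and lim: "((\<lambda>u. E u / R u) \<longlongrightarrow> c) F" and c: "c < 0"
  shows "((\<lambda>u. exp (E u)) \<longlongrightarrow> 0) F"
proof -
  have "filterlim (\<lambda>u. E u / R u * R u) at_bot F"
    using lim c R by (rule filterlim_tendsto_neg_mult_at_bot)
  moreover have "eventually (\<lambda>u. R u > 0) F"
    using filterlim_at_top_dense R by blast
  then have "eventually (\<lambda>u. E u / R u * R u = E u) F"
    by eventually_elim auto
  ultimately have "filterlim E at_bot F"
    using filterlim_cong by fast
  then show ?thesis by (rule filterlim_compose[OF exp_at_bot])
qed

text \<open>Up to lower order, the first tail contributes \<open>- K^2 * L / 2\<close> to the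
  exponent, the squared density ratio \<open>2 * a * hl * L\<close>, and the crude factor
  \<open>exp s\<close>, squared, \<open>2 * a * L\<close>. The condition on \<open>K\<close> makes
  the total negative. With \<open>L = ln u\<close> this compares powers of \<open>u\<close>.\<close>

lemma gauss_tail_shift_square_eventually:
  fixes s h L :: "'a \<Rightarrow> real"
  assumes L: "filterlim L at_top F" and s: "((\<lambda>u. s u / L u) \<longlongrightarrow> a) F" and a: "a > 0"
    and h: "(h \<longlongrightarrow> hl) F" and K: "K > 0" "2 * a * hl + 2 * a < K\<^sup>2 / 2" and \<epsilon>: "\<epsilon> > 0"
  shows "eventually (\<lambda>u. gauss_tail (K * sqrt (L u)) * (gauss_tail (s u - h u))\<^sup>2 \<le> \<epsilon> * (gauss_tail (s u))\<^sup>2) F"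
proof -
  have L_pos: "eventually (\<lambda>u. L u > 0) F" using filterlim_at_top_dense L by blast
  have iL: "((\<lambda>u. 1 / L u) \<longlongrightarrow> 0) F"
    using tendsto_inverse_0_at_top[OF L] by (simp add: divide_inverse)
  have s_top: "filterlim s at_top F"
  proof -
    have "filterlim (\<lambda>u. s u / L u * L u) at_top F"
      using s a L by (rule filterlim_tendsto_pos_mult_at_top)
    moreover have "eventually (\<lambda>u. s u / L u * L u = s u) F" using L_pos by eventually_elim auto
    ultimately show ?thesis using filterlim_cong by fast
  qed
  let ?E = "\<lambda>u. 2 * s u + ((s u)\<^sup>2 - (s u - h u)\<^sup>2) - K\<^sup>2 * L u / 2"
  have "((\<lambda>u. exp (?E u)) \<longlongrightarrow> 0) F"
  proof (rule exp_tendsto_0_if_neg_rate[OF L])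
    have "((\<lambda>u. 2 * (s u / L u) + (2 * (s u / L u) * h u - h u * h u * (1 / L u)) - K\<^sup>2 / 2) \<longlongrightarrow>
        2 * a + (2 * a * hl - hl * hl * 0) - K\<^sup>2 / 2) F"
      by (intro tendsto_intros s h iL)
    moreover have "eventually (\<lambda>u. 2 * (s u / L u) + (2 * (s u / L u) * h u - h u * h u * (1 / L u)) - K\<^sup>2 / 2
        = ?E u / L u) F"
      using L_pos by eventually_elim (simp add: field_simps power2_eq_square)
    ultimately show "((\<lambda>u. ?E u / L u) \<longlongrightarrow> 2 * a + (2 * a * hl - hl * hl * 0) - K\<^sup>2 / 2) F"
      by (rule Lim_transform_eventually)
    show "2 * a + (2 * a * hl - hl * hl * 0) - K\<^sup>2 / 2 < 0" using K by simp
  qed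
  then have "eventually (\<lambda>u. exp (?E u) < \<epsilon> / 4) F"
    using \<epsilon> by (intro order_tendstoD(2)) auto
  moreover have "eventually (\<lambda>u. h u < hl + 1) F"
    using h by (rule order_tendstoD(2)) simp
  \<comment> \<open>Together with \<open>h u < hl + 1\<close> this gives
    \<open>s u - h u \<ge> 1\<close>, and the bound on \<open>L\<close> gives
    \<open>K * sqrt (L u) \<ge> 1\<close>, as the crude tail estimates require.\<close>
  moreover have "eventually (\<lambda>u. s u \<ge> \<bar>hl\<bar> + 2) F" "eventually (\<lambda>u. L u \<ge> (1 / K)\<^sup>2) F"
    using s_top L unfolding filterlim_at_top by blast+
  ultimately show ?thesis
    using L_pos
  proof eventually_elim
    case (elim u)
    have "sqrt (L u) \<ge> 1 / K" using elim K by (intro real_le_rsqrt) auto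
    then have KL: "K * sqrt (L u) \<ge> 1" using K by (simp add: field_simps)
    have "gauss_tail (K * sqrt (L u)) * (gauss_tail (s u - h u))\<^sup>2
        \<le> exp (- (K * sqrt (L u))\<^sup>2 / 2) * (std_normal_density (s u - h u))\<^sup>2"
      using elim KL by (intro mult_mono gauss_tail_le_exp power_mono gauss_tail_le_density gauss_tail_nonneg) auto
    also have "\<dots> = exp (- K\<^sup>2 * L u / 2) * exp ((s u)\<^sup>2 - (s u - h u)\<^sup>2) * (std_normal_density (s u))\<^sup>2"
      using elim unfolding std_normal_density_def
      by (simp add: power_mult_distrib power_divide exp_double[symmetric] exp_add[symmetric])
    also have "\<dots> \<le> exp (- K\<^sup>2 * L u / 2) * exp ((s u)\<^sup>2 - (s u - h u)\<^sup>2) * (2 * exp (s u) * gauss_tail (s u))\<^sup>2"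
      using elim by (intro mult_left_mono power_mono gauss_tail_ge_density) auto
    also have "\<dots> = 4 * exp (?E u) * (gauss_tail (s u))\<^sup>2"
      by (simp add: power_mult_distrib exp_double[symmetric] exp_add[symmetric] algebra_simps)
    also have "\<dots> \<le> \<epsilon> * (gauss_tail (s u))\<^sup>2"
      using elim by (intro mult_right_mono) auto
    finally show ?case .
  qed
qed

text \<open>The exponents are now quadratic in \<open>L\<close>. Divided by \<open>L^2\<close>,
  their sum tends to \<open>(a'^2 - a^2) / 2 < 0\<close>, while the shift \<open>h\<close> and the
  factors \<open>exp s\<close> and \<open>exp s'\<close> are of order \<open>L\<close> only.\<close>

lemma gauss_tail_lighter_eventually:
  fixes s s' h L :: "'a \<Rightarrow> real"
  assumes L: "filterlim L at_top F" and s: "((\<lambda>u. s u / L u) \<longlongrightarrow> a) F" and s': "((\<lambda>u. s' u / L u) \<longlongrightarrow> a') F"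
    and a: "0 < a'" "a' < a" and h: "(h \<longlongrightarrow> hl) F" and \<epsilon>: "\<epsilon> > 0"
  shows "eventually (\<lambda>u. (gauss_tail (s u - h u))\<^sup>2 \<le> \<epsilon> * gauss_tail (s u) * gauss_tail (s' u)) F"
proof -
  have L_pos: "eventually (\<lambda>u. L u > 0) F" using filterlim_at_top_dense L by blast
  have iL: "((\<lambda>u. 1 / L u) \<longlongrightarrow> 0) F"
    using tendsto_inverse_0_at_top[OF L] by (simp add: divide_inverse)
  have top: "filterlim f at_top F" if "((\<lambda>u. f u / L u) \<longlongrightarrow> b) F" "b > 0" for f b
  proof -
    have "filterlim (\<lambda>u. f u / L u * L u) at_top F"
      using that L by (rule filterlim_tendsto_pos_mult_at_top)
    moreover have "eventually (\<lambda>u. f u / L u * L u = f u) F" using L_pos by eventually_elim auto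
    ultimately show ?thesis using filterlim_cong by fast
  qed
  let ?E = "\<lambda>u. s u + s' u + (s u)\<^sup>2 / 2 + (s' u)\<^sup>2 / 2 - (s u - h u)\<^sup>2"
  have "((\<lambda>u. exp (?E u)) \<longlongrightarrow> 0) F"
  proof (rule exp_tendsto_0_if_neg_rate)
    show "filterlim (\<lambda>u. (L u)\<^sup>2) at_top F" by (rule filterlim_pow_at_top[OF _ L]) simp
    have "((\<lambda>u. s u / L u * (1 / L u) + s' u / L u * (1 / L u) + (s u / L u)\<^sup>2 / 2 + (s' u / L u)\<^sup>2 / 2
         - (s u / L u - h u * (1 / L u))\<^sup>2) \<longlongrightarrow>
        a * 0 + a' * 0 + a\<^sup>2 / 2 + a'\<^sup>2 / 2 - (a - hl * 0)\<^sup>2) F"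
      by (intro tendsto_intros s s' h iL) auto
    moreover have "eventually (\<lambda>u. s u / L u * (1 / L u) + s' u / L u * (1 / L u) + (s u / L u)\<^sup>2 / 2 + (s' u / L u)\<^sup>2 / 2
         - (s u / L u - h u * (1 / L u))\<^sup>2 = ?E u / (L u)\<^sup>2) F"
      using L_pos by eventually_elim (simp add: field_simps power2_eq_square)
    ultimately show "((\<lambda>u. ?E u / (L u)\<^sup>2) \<longlongrightarrow> a * 0 + a' * 0 + a\<^sup>2 / 2 + a'\<^sup>2 / 2 - (a - hl * 0)\<^sup>2) F"
      by (rule Lim_transform_eventually)
    show "a * 0 + a' * 0 + a\<^sup>2 / 2 + a'\<^sup>2 / 2 - (a - hl * 0)\<^sup>2 < 0"
      using power_strict_mono[of a' a 2] a by simp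
  qed
  then have "eventually (\<lambda>u. exp (?E u) < \<epsilon> / 4) F"
    using \<epsilon> by (intro order_tendstoD(2)) auto
  moreover have "eventually (\<lambda>u. h u < hl + 1) F"
    using h by (rule order_tendstoD(2)) simp
  moreover have "eventually (\<lambda>u. s u \<ge> \<bar>hl\<bar> + 2) F" "eventually (\<lambda>u. s' u \<ge> 1) F"
    using top[OF s] top[OF s'] a unfolding filterlim_at_top by auto
  ultimately show ?thesis
  proof eventually_elim
    case (elim u)
    have "(gauss_tail (s u - h u))\<^sup>2 \<le> (std_normal_density (s u - h u))\<^sup>2"
      using elim by (intro power_mono gauss_tail_le_density gauss_tail_nonneg) auto
    also have "\<dots> = exp ((s u)\<^sup>2 / 2 + (s' u)\<^sup>2 / 2 - (s u - h u)\<^sup>2) * (std_normal_density (s u) * std_normal_density (s' u))"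
      unfolding std_normal_density_def
      by (simp add: power_mult_distrib power_divide exp_double[symmetric] exp_add[symmetric])
    also have "\<dots> \<le> exp ((s u)\<^sup>2 / 2 + (s' u)\<^sup>2 / 2 - (s u - h u)\<^sup>2) *
        ((2 * exp (s u) * gauss_tail (s u)) * (2 * exp (s' u) * gauss_tail (s' u)))"
      using elim gauss_tail_nonneg by (intro mult_left_mono mult_mono gauss_tail_ge_density) auto
    also have "\<dots> = 4 * exp (?E u) * (gauss_tail (s u) * gauss_tail (s' u))"
      by (simp add: exp_add[symmetric] algebra_simps)
    also have "\<dots> \<le> \<epsilon> * (gauss_tail (s u) * gauss_tail (s' u))"
      using elim gauss_tail_nonneg by (intro mult_right_mono) auto
    finally show ?case by (simp add: mult_ac)
  qed
qed

section \<open>Pointwise bounds for the conditional probabilities\<close>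

text \<open>The value of \<open>Y_i\<close> at which \<open>X_i\<close> equals
  \<open>u\<close>.\<close>

definition level :: "(nat \<Rightarrow> real) \<Rightarrow> (nat \<Rightarrow> real) \<Rightarrow> real \<Rightarrow> real \<Rightarrow> nat \<Rightarrow> real" where
  "level lam beta gu u i = ln (u / lam i) / (beta i * gu)"

text \<open>The part of \<open>Y_i\<close> that is free of \<open>N_j\<close>. It is encoded by
  zeroing one coefficient, so that it is again a linear functional of the whole vector and the
  results on \<open>gaussN\<close> apply.\<close>

definition residual :: "nat \<Rightarrow> (nat \<Rightarrow> nat \<Rightarrow> real) \<Rightarrow> nat \<Rightarrow> nat \<Rightarrow> (nat \<Rightarrow> real) \<Rightarrow> real" where
  "residual d A j i n = (\<Sum>k<d. ((A i)(j := 0)) k * n k)"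

lemma less_scaled_exp_iff:
  fixes v l b t :: real
  assumes "v > 0" "l > 0" "b > 0"
  shows "v < l * exp (b * t) \<longleftrightarrow> ln (v / l) / b < t"
proof -
  have "v < l * exp (b * t) \<longleftrightarrow> v / l < exp (b * t)" using assms by (simp add: field_simps)
  also have "\<dots> \<longleftrightarrow> ln (v / l) < b * t" using assms ln_less_cancel_iff[of "v / l" "exp (b * t)"] by simp
  finally show ?thesis using assms by (simp add: field_simps)
qed

lemma ptail_eq_gauss_tail:
  assumes "u > 0" "lam i > 0" "beta i > 0" "gu > 0"
  shows "ptail lam beta gu u i = gauss_tail (level lam beta gu u i)"
  unfolding ptail_def gauss_tail_def level_def
  using assms by (simp add: less_scaled_exp_iff greaterThan_def)

lemma Yv_update:
  assumes "j < d"
  shows "Yv d A (n(j := t)) i = A i j * t + residual d A j i n"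
proof -
  have "(\<Sum>k<d. A i k * (n(j := t)) k) = (\<Sum>k<d. ((A i)(j := 0)) k * n k + (if k = j then A i j * t else 0))"
    by (intro sum.cong) auto
  then show ?thesis using assms by (simp add: Yv_def residual_def sum.distrib)
qed

lemma Yv_update_self:
  assumes "j < d" "\<And>k. k < d \<Longrightarrow> A j k = (if k = j then 1 else 0)"
  shows "Yv d A (n(j := t)) j = t"
proof -
  have "residual d A j j n = 0" unfolding residual_def using assms by (intro sum.neutral) auto
  then show ?thesis using assms by (simp add: Yv_update)
qed

lemma Xv_eq_Mmax_iff:
  assumes "j < d"
  shows "Xv d lam beta gu A n j = Mmax d lam beta gu A n \<longleftrightarrow> (\<forall>i<d. Xv d lam beta gu A n i \<le> Xv d lam beta gu A n j)"
proof -
  have "finite (Xv d lam beta gu A n ` {..<d})" "Xv d lam beta gu A n ` {..<d} \<noteq> {}" using assms by auto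
  then show ?thesis unfolding Mmax_def using assms by (subst eq_commute, subst Max_eq_iff) auto
qed

section \<open>Bounds for one fixed \<open>u\<close> and one matrix whose row \<open>j\<close> is a
  unit vector\<close>

context
  fixes d :: nat and lam beta :: "nat \<Rightarrow> real" and gu u :: real and A :: "nat \<Rightarrow> nat \<Rightarrow> real" and j :: nat
  assumes pos: "\<And>i. i < d \<Longrightarrow> lam i > 0" "\<And>i. i < d \<Longrightarrow> beta i > 0" "gu > 0" "u > 0"
    and j: "j < d" and row: "\<And>k. k < d \<Longrightarrow> A j k = (if k = j then 1 else 0)"
begin

lemma pos_j: "lam j > 0" "beta j > 0" "beta j \<noteq> 0" "lam j \<noteq> 0" "gu \<noteq> 0"
  using pos(1,2)[OF j] pos(3) by auto

lemma Xv_update: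
  "i < d \<Longrightarrow> Xv d lam beta gu A (n(j := t)) i = lam i * exp (beta i * gu * (A i j * t + residual d A j i n))"
  "Xv d lam beta gu A (n(j := t)) j = lam j * exp (beta j * gu * t)"
  by (simp add: Xv_def Yv_update j) (subst Xv_def, simp add: Yv_update_self j row)

text \<open>If \<open>X_j\<close> is the largest summand then the sum is at most
  \<open>d * X_j\<close>, hence \<open>X_j > u / d\<close>; on the scale of \<open>t\<close> this
  lowers the level by \<open>ln d / (beta j * gu)\<close>.\<close>

lemma Zcond_event_imp_gt:
  assumes S: "Ssum d lam beta gu A (n(j := t)) > u"
    and M: "\<And>i. i < d \<Longrightarrow> Xv d lam beta gu A (n(j := t)) i \<le> Xv d lam beta gu A (n(j := t)) j"
  shows "t > level lam beta gu u j - ln (real d) / (beta j * gu)"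
proof -
  have d: "real d > 0" using j by simp
  have "u < Ssum d lam beta gu A (n(j := t))" by fact
  also have "\<dots> \<le> (\<Sum>i<d. Xv d lam beta gu A (n(j := t)) j)"
    unfolding Ssum_def by (intro sum_mono M) auto
  also have "\<dots> = (d * lam j) * exp (beta j * gu * t)" by (simp add: Xv_update)
  finally have "ln (u / (d * lam j)) / (beta j * gu) < t"
    using pos pos_j j d by (subst (asm) less_scaled_exp_iff) auto
  moreover have "ln (u / (d * lam j)) = ln (u / lam j) - ln d"
    using pos pos_j j d by (simp add: ln_div ln_mult)
  ultimately show ?thesis unfolding level_def by (simp add: diff_divide_distrib)
qed

lemma measurable_Xv_update [measurable]:
  "(\<lambda>t. Xv d lam beta gu A (n(j := t)) i) \<in> borel_measurable borel"
  unfolding Xv_def Yv_update[OF j] by measurable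

lemma measurable_Ssum_update [measurable]:
  "(\<lambda>t. Ssum d lam beta gu A (n(j := t))) \<in> borel_measurable borel"
  unfolding Ssum_def by measurable

lemma Zcond_le: "Zcond d lam beta gu A u j n \<le> gauss_tail (level lam beta gu u j - ln (real d) / (beta j * gu))"
  unfolding Zcond_def gauss_tail_def Xv_eq_Mmax_iff[OF j]
  by (intro std_gauss.finite_measure_mono) (auto dest: Zcond_event_imp_gt)

section \<open>Sharper bounds when the other summands are at most \<open>r\<close> at the critical
  level\<close>

context
  fixes n :: "nat \<Rightarrow> real" and r :: real
  assumes beta_le: "\<And>i. i < d \<Longrightarrow> beta i \<le> beta j" and corr: "\<And>i. i < d \<Longrightarrow> \<bar>A i j\<bar> \<le> 1"
    and r: "\<And>i. i < d \<Longrightarrow> i \<noteq> j \<Longrightarrow>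
      lam i * exp (beta i * gu * (A i j * level lam beta gu u j + residual d A j i n)) \<le> r"
begin

text \<open>Moving \<open>t\<close> away from the level by at most \<open>h\<close> changes the
  exponent of \<open>X_i\<close> by at most \<open>beta j * gu * h\<close>, because
  \<open>A i j\<close> is at most 1 in modulus and \<open>beta j\<close> is maximal.\<close>

lemma Xv_update_shift_le:
  assumes i: "i < d" "i \<noteq> j" and h: "\<bar>t - level lam beta gu u j\<bar> \<le> h"
  shows "Xv d lam beta gu A (n(j := t)) i \<le> exp (beta j * gu * h) * r"
proof -
  define y where "y = level lam beta gu u j"
  have "A i j * (t - y) \<le> 1 * h"
    using mult_mono[of "\<bar>A i j\<bar>" 1 "\<bar>t - y\<bar>" h] corr[of i] h i by (simp add: y_def flip: abs_mult)
  then have "beta i * gu * (A i j * (t - y)) \<le> beta i * gu * h"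
    using pos(2)[OF i(1)] pos(3) by (intro mult_left_mono) auto
  also have "\<dots> \<le> beta j * gu * h"
    using pos beta_le i h by (intro mult_right_mono) auto
  finally have "exp (beta i * gu * (A i j * (t - y))) \<le> exp (beta j * gu * h)" by simp
  then have "exp (beta i * gu * (A i j * (t - y))) * (lam i * exp (beta i * gu * (A i j * y + residual d A j i n)))
     \<le> exp (beta j * gu * h) * r"
    using r[of i] i pos by (intro mult_mono) (auto simp: y_def intro: less_imp_le)
  also have "exp (beta i * gu * (A i j * (t - y))) * (lam i * exp (beta i * gu * (A i j * y + residual d A j i n)))
     = Xv d lam beta gu A (n(j := t)) i"
    using i by (simp add: Xv_update algebra_simps flip: exp_add)
  finally show ?thesis .
qed

text \<open>Below the level, \<open>t\<close> is still within \<open>ln d / (beta j * gu)\<close> of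
  it, so each other summand has grown by at most the factor \<open>d\<close> over \<open>r\<close>.
  Fewer than \<open>d\<close> summands of size at most \<open>d * r\<close> leave
  \<open>X_j > u - d^2 * r\<close>.\<close>

lemma Zcond_le_good:
  assumes "0 \<le> r" "(real d)\<^sup>2 * r < u"
  shows "Zcond d lam beta gu A u j n \<le> gauss_tail (ln ((u - (real d)\<^sup>2 * r) / lam j) / (beta j * gu))"
  unfolding Zcond_def gauss_tail_def Xv_eq_Mmax_iff[OF j]
proof (rule std_gauss.finite_measure_mono, safe)
  fix t assume S: "Ssum d lam beta gu A (n(j := t)) > u"
    and M: "\<forall>i<d. Xv d lam beta gu A (n(j := t)) i \<le> Xv d lam beta gu A (n(j := t)) j"
  let ?y = "level lam beta gu u j" and ?h = "ln (real d) / (beta j * gu)"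
  have d: "real d \<ge> 1" using j by simp
  have "u - (real d)\<^sup>2 * r < lam j * exp (beta j * gu * t)"
  proof (cases "?y < t")
    case True
    then have "u < lam j * exp (beta j * gu * t)"
      unfolding level_def using pos pos_j j by (subst less_scaled_exp_iff) auto
    moreover have "0 \<le> (real d)\<^sup>2 * r" using assms by simp
    ultimately show ?thesis by linarith
  next
    case False
    have t: "\<bar>t - ?y\<bar> \<le> ?h"
      using Zcond_event_imp_gt[OF S] M False by auto
    have "exp (beta j * gu * ?h) = d" using pos pos_j j d by simp
    then have *: "Xv d lam beta gu A (n(j := t)) i \<le> d * r" if "i < d" "i \<noteq> j" for i
      using Xv_update_shift_le[OF that t] by simp
    have "u < Ssum d lam beta gu A (n(j := t))" by fact
    also have "\<dots> = Xv d lam beta gu A (n(j := t)) j + (\<Sum>i\<in>{..<d} - {j}. Xv d lam beta gu A (n(j := t)) i)"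
      unfolding Ssum_def using j by (subst sum.remove[of _ j]) auto
    also have "\<dots> \<le> Xv d lam beta gu A (n(j := t)) j + (\<Sum>i\<in>{..<d} - {j}. d * r)"
      using * by (intro add_left_mono sum_mono) auto
    also have "(\<Sum>i\<in>{..<d} - {j}. d * r) \<le> (\<Sum>i\<in>{..<d}. d * r)"
      using assms by (intro sum_mono2) auto
    finally show ?thesis unfolding Xv_update(2) by (simp add: power2_eq_square mult.assoc)
  qed
  then show "t > ln ((u - (real d)\<^sup>2 * r) / lam j) / (beta j * gu)"
    using assms pos j by (subst (asm) less_scaled_exp_iff) auto
qed auto

text \<open>Above the level, \<open>X_j\<close> grows from exactly \<open>u\<close> by the factor
  \<open>exp (beta j * gu * (t - y))\<close>, and the others grow from at most
  \<open>r \<le> u\<close> by no more than this factor. So \<open>X_j\<close> stays maximal, and it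
  alone exceeds \<open>u\<close>.\<close>

lemma Zcond_ge_good:
  assumes "r \<le> u"
  shows "gauss_tail (level lam beta gu u j) \<le> Zcond d lam beta gu A u j n"
  unfolding Zcond_def gauss_tail_def Xv_eq_Mmax_iff[OF j]
proof (rule std_gauss.finite_measure_mono, safe)
  fix t assume t: "t > level lam beta gu u j"
  define y where "y = level lam beta gu u j"
  have yj: "u = lam j * exp (beta j * gu * y)"
    unfolding y_def level_def using pos pos_j j by (simp add: exp_ln less_imp_neq[symmetric])
  have gt: "u < lam j * exp (beta j * gu * t)"
    using t unfolding level_def using pos pos_j j by (subst less_scaled_exp_iff) auto
  also have "\<dots> = Xv d lam beta gu A (n(j := t)) j" by (simp add: Xv_update)
  also have "\<dots> \<le> Ssum d lam beta gu A (n(j := t))"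
    unfolding Ssum_def using j pos by (intro member_le_sum) (auto simp: Xv_def intro!: mult_nonneg_nonneg less_imp_le)
  finally show "u < Ssum d lam beta gu A (n(j := t))" .
  fix i assume i: "i < d"
  show "Xv d lam beta gu A (n(j := t)) i \<le> Xv d lam beta gu A (n(j := t)) j"
  proof (cases "i = j")
    case False
    have "Xv d lam beta gu A (n(j := t)) i \<le> exp (beta j * gu * (t - y)) * r"
      using t by (intro Xv_update_shift_le i False) (simp add: y_def)
    also have "\<dots> \<le> exp (beta j * gu * (t - y)) * u" using assms by simp
    also have "\<dots> = Xv d lam beta gu A (n(j := t)) j"
      by (subst yj) (simp add: Xv_update right_diff_distrib flip: exp_add)
    finally show ?thesis .
  qed simp
qed auto

end

end

text \<open>At the critical level the exponent of \<open>X_i\<close> is \<open>bi / bj\<close> times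
  \<open>s * ln (u / lj) + bj * g * w\<close>. The bound on \<open>w\<close> makes the second term
  at most \<open>ln u\<close> times the square-root term of \<open>cond\<close>. Hence
  \<open>cond\<close>, multiplied by \<open>ln u\<close>, bounds \<open>X_i\<close> by a small
  multiple of \<open>e_star\<close>, which is of order \<open>u / ln u\<close>.\<close>

lemma residual_small_imp_Xv_small_eventually:
  fixes s g :: "real \<Rightarrow> real"
  assumes pos: "li > 0" "lj > 0" "bi > 0" "bj > 0" "\<gamma> > 0" "K > 0" "\<delta> > 0"
    and g: "(g \<longlongrightarrow> \<gamma>) at_top"
    and s: "eventually (\<lambda>u. \<bar>s u\<bar> \<le> 1) at_top"
    and cond: "\<And>c \<epsilon>. c > 0 \<Longrightarrow> \<epsilon> > 0 \<Longrightarrow> eventually (\<lambda>u. s u + c * sqrt ((1 - (s u)\<^sup>2) / ln u)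
      \<le> bj / bi * (ln (\<epsilon> * ((bi * g u)\<^sup>2 * u / ln (u / li))) / ln u)) at_top"
  shows "eventually (\<lambda>u. \<forall>w. w \<le> K * sqrt (ln u) * sqrt (1 - (s u)\<^sup>2) \<longrightarrow>
      li * exp (bi * g u * (s u * (ln (u / lj) / (bj * g u)) + w)) \<le> \<delta> * u / ln u) at_top"
proof -
  \<comment> \<open>\<open>c\<close> absorbs \<open>K\<close> and the eventual bound
    \<open>g u < 2 * \<gamma>\<close>; \<open>C\<close> absorbs \<open>li\<close> and the
    contribution of \<open>ln lj\<close>. In \<open>\<epsilon>\<close>, 8 is 4 from the square of
    \<open>2 * \<gamma>\<close> times 2 from \<open>ln (u / li) \<ge> ln u / 2\<close>.\<close>
  define c where "c = bj * (2 * \<gamma>) * K"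
  define C where "C = li * exp (bi / bj * \<bar>ln lj\<bar>)"
  define \<epsilon> where "\<epsilon> = \<delta> / (C * (8 * (bi * \<gamma>)\<^sup>2))"
  have pos': "c > 0" "C > 0" "\<epsilon> > 0" using pos by (auto simp: c_def C_def \<epsilon>_def)
  have "eventually (\<lambda>u. g u < 2 * \<gamma>) at_top" "eventually (\<lambda>u. g u > 0) at_top"
    using pos by (auto intro!: order_tendstoD[OF g])
  moreover have "eventually (\<lambda>u. ln u > 2 * \<bar>ln li\<bar>) at_top" "eventually (\<lambda>u. u > (1::real)) at_top"
    using filterlim_at_top_dense[of "ln :: real \<Rightarrow> real"] ln_at_top eventually_gt_at_top by blast+
  ultimately show ?thesis
    using s cond[OF pos'(1,3)]
  proof eventually_elim
    case (elim u)
    let ?L = "ln u"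
    let ?q = "sqrt (1 - (s u)\<^sup>2)"
    have L: "?L > 0" "?L - ln li \<ge> ?L / 2" "?L - ln li > 0" using elim by (auto simp: abs_if split: if_splits)
    have lnu: "ln (u / li) = ?L - ln li" using elim pos by (simp add: ln_div)
    have e: "(bi * g u)\<^sup>2 * u / ln (u / li) \<le> 8 * (bi * \<gamma>)\<^sup>2 * (u / ?L)"
    proof -
      have "(bi * g u)\<^sup>2 * u / ln (u / li) \<le> (bi * (2 * \<gamma>))\<^sup>2 * u / (?L / 2)"
        unfolding lnu using elim pos L by (intro frac_le mult_right_mono power_mono) auto
      then show ?thesis by (simp add: field_simps power2_eq_square)
    qed
    have e_pos: "(bi * g u)\<^sup>2 * u / ln (u / li) > 0"
      unfolding lnu using elim pos L by (intro divide_pos_pos mult_pos_pos) auto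
    show ?case
    proof (intro allI impI)
      fix w assume w: "w \<le> K * sqrt ?L * ?q"
      have "bj * g u * w \<le> bj * g u * (K * sqrt ?L * ?q)"
        using w elim pos by (intro mult_left_mono) auto
      also have "\<dots> \<le> bj * (2 * \<gamma>) * (K * sqrt ?L * ?q)"
        using elim pos L by (intro mult_right_mono mult_left_mono mult_nonneg_nonneg) (auto simp: abs_square_le_1)
      also have "\<dots> = ?L * (c * sqrt ((1 - (s u)\<^sup>2) / ?L))"
        using L real_sqrt_pow2[of ?L] by (simp add: c_def real_sqrt_divide field_simps power2_eq_square)
      finally have "s u * ?L + bj * g u * w \<le> ?L * (s u + c * sqrt ((1 - (s u)\<^sup>2) / ?L))"
        by (simp add: algebra_simps)
      also have "\<dots> \<le> ?L * (bj / bi * (ln (\<epsilon> * ((bi * g u)\<^sup>2 * u / ln (u / li))) / ?L))"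
        using elim L by (intro mult_left_mono) auto
      also have "\<dots> = bj / bi * ln (\<epsilon> * ((bi * g u)\<^sup>2 * u / ln (u / li)))"
        using L by simp
      finally have 1: "bi / bj * (s u * ?L + bj * g u * w) \<le> ln (\<epsilon> * ((bi * g u)\<^sup>2 * u / ln (u / li)))"
        using pos by (simp add: field_simps)
      have "- (s u * ln lj) \<le> \<bar>s u\<bar> * \<bar>ln lj\<bar>" by (simp add: abs_mult[symmetric])
      also have "\<dots> \<le> 1 * \<bar>ln lj\<bar>" using elim by (intro mult_right_mono) auto
      finally have 2: "bi / bj * - (s u * ln lj) \<le> bi / bj * \<bar>ln lj\<bar>"
        using pos by (intro mult_left_mono) auto
      have "bi * g u * (s u * (ln (u / lj) / (bj * g u)) + w)
          = bi / bj * - (s u * ln lj) + bi / bj * (s u * ?L + bj * g u * w)"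
        using elim pos by (simp add: ln_div field_simps)
      also have "\<dots> \<le> bi / bj * \<bar>ln lj\<bar> + ln (\<epsilon> * ((bi * g u)\<^sup>2 * u / ln (u / li)))"
        using 1 2 by simp
      finally have "exp (bi * g u * (s u * (ln (u / lj) / (bj * g u)) + w))
         \<le> exp (bi / bj * \<bar>ln lj\<bar>) * (\<epsilon> * ((bi * g u)\<^sup>2 * u / ln (u / li)))"
        using e_pos pos' by (metis exp_add exp_le_cancel_iff exp_ln mult_pos_pos)
      then have "li * exp (bi * g u * (s u * (ln (u / lj) / (bj * g u)) + w))
         \<le> li * (exp (bi / bj * \<bar>ln lj\<bar>) * (\<epsilon> * ((bi * g u)\<^sup>2 * u / ln (u / li))))"
        using pos by (intro mult_left_mono) auto
      also have "\<dots> \<le> li * (exp (bi / bj * \<bar>ln lj\<bar>) * (\<epsilon> * (8 * (bi * \<gamma>)\<^sup>2 * (u / ?L))))"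
        using pos pos' e by (intro mult_left_mono) auto
      also have "\<dots> = \<delta> * u / ?L"
        using pos pos' by (simp add: \<epsilon>_def C_def field_simps)
      finally show "li * exp (bi * g u * (s u * (ln (u / lj) / (bj * g u)) + w)) \<le> \<delta> * u / ?L" .
    qed
  qed
qed

section \<open>Moments of the estimator\<close>

lemma measurable_Xv [measurable]: "(\<lambda>n. Xv d lam beta gu A n i) \<in> borel_measurable (gaussN d)"
  unfolding Xv_def by measurable

lemma measurable_Ssum [measurable]: "Ssum d lam beta gu A \<in> borel_measurable (gaussN d)"
  unfolding Ssum_def[abs_def] by measurable

text \<open>The maximum is expressed by pairwise comparisons instead of \<open>Mmax\<close>, which
  makes measurability a matter of finitely many inequalities.\<close>

definition dominant_event :: "nat \<Rightarrow> (nat \<Rightarrow> real) \<Rightarrow> (nat \<Rightarrow> real) \<Rightarrow> real \<Rightarrow>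
    (nat \<Rightarrow> nat \<Rightarrow> real) \<Rightarrow> real \<Rightarrow> nat \<Rightarrow> (nat \<Rightarrow> real) set" where
  "dominant_event d lam beta gu A u j = {n \<in> space (gaussN d). Ssum d lam beta gu A n > u \<and>
     (\<forall>i<d. Xv d lam beta gu A n i \<le> Xv d lam beta gu A n j)}"

lemma sets_dominant_event [measurable]: "dominant_event d lam beta gu A u j \<in> sets (gaussN d)"
proof -
  have [measurable]: "Measurable.pred (gaussN d) (\<lambda>n. Xv d lam beta gu A n i \<le> Xv d lam beta gu A n j)" for i
    unfolding pred_def by (intro borel_measurable_le measurable_Xv)
  have "{n \<in> space (gaussN d). Ssum d lam beta gu A n > u \<and>
     (\<forall>i\<in>{..<d}. Xv d lam beta gu A n i \<le> Xv d lam beta gu A n j)} \<in> sets (gaussN d)"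
    by measurable
  then show ?thesis by (simp add: dominant_event_def lessThan_def)
qed

lemma Zcond_bounds: "0 \<le> Zcond d lam beta gu A u j n" "Zcond d lam beta gu A u j n \<le> 1"
  unfolding Zcond_def by auto

text \<open>Puts the conditional probability in the form required by the lemmas on resampling
  coordinate \<open>j\<close>; measurability and expectation follow from them. Membership in the
  space keeps the updated vector extensional.\<close>

lemma ennreal_Zcond:
  assumes j: "j < d" and n: "n \<in> space (gaussN d)"
  shows "ennreal (Zcond d lam beta gu A u j n)
    = (\<integral>\<^sup>+t. indicator (dominant_event d lam beta gu A u j) (n(j := t)) \<partial>std_gauss)"
proof -
  have sp: "n(j := t) \<in> space (gaussN d)" for t
    using j n by (auto simp: space_gaussN PiE_iff extensional_def)
  have [measurable]: "(\<lambda>t. Xv d lam beta gu A (n(j := t)) i) \<in> borel_measurable borel" for i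
    unfolding Xv_def Yv_update[OF j] by measurable
  have [measurable]: "{t. Ssum d lam beta gu A (n(j := t)) > u \<and>
        (\<forall>i<d. Xv d lam beta gu A (n(j := t)) i \<le> Xv d lam beta gu A (n(j := t)) j)} \<in> sets borel" (is "?T \<in> _")
  proof -
    have "{t \<in> space borel. (\<Sum>i<d. Xv d lam beta gu A (n(j := t)) i) > u \<and>
        (\<forall>i\<in>{..<d}. Xv d lam beta gu A (n(j := t)) i \<le> Xv d lam beta gu A (n(j := t)) j)} \<in> sets borel"
      by measurable
    then show ?thesis by (simp add: Ssum_def lessThan_def)
  qed
  have "Zcond d lam beta gu A u j n = measure std_gauss ?T"
    by (simp add: Zcond_def Xv_eq_Mmax_iff[OF j])
  then have "ennreal (Zcond d lam beta gu A u j n) = (\<integral>\<^sup>+t. indicator ?T t \<partial>std_gauss)"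
    by (simp add: std_gauss.emeasure_eq_measure)
  also have "\<dots> = (\<integral>\<^sup>+t. indicator (dominant_event d lam beta gu A u j) (n(j := t)) \<partial>std_gauss)"
    by (intro nn_integral_cong) (auto simp: indicator_def dominant_event_def sp)
  finally show ?thesis .
qed

lemma measurable_Zcond:
  assumes j: "j < d"
  shows "Zcond d lam beta gu A u j \<in> borel_measurable (gaussN d)"
proof -
  have [measurable]: "(\<lambda>n. \<integral>\<^sup>+t. indicator (dominant_event d lam beta gu A u j) (n(j := t)) \<partial>std_gauss)
      \<in> borel_measurable (gaussN d)"
    by (intro measurable_nn_integral_resample borel_measurable_indicator sets_dominant_event j)
  have "(\<lambda>n. enn2real (\<integral>\<^sup>+t. indicator (dominant_event d lam beta gu A u j) (n(j := t)) \<partial>std_gauss))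
      \<in> borel_measurable (gaussN d)"
    by (rule borel_measurable_enn2real) fact
  then show ?thesis
    by (rule measurable_cong[THEN iffD1, rotated])
      (simp add: ennreal_Zcond[OF j, symmetric] Zcond_bounds)
qed

lemma integrable_Zcond_power:
  assumes j: "j < d"
  shows "integrable (gaussN d) (\<lambda>n. Zcond d lam beta gu A u j n ^ m)"
  using measurable_Zcond[OF j] Zcond_bounds
  by (intro gaussN.integrable_const_bound[where B = 1]) (auto intro!: power_le_one)

text \<open>Tower property: integrating the resampled indicator over the whole vector returns the
  probability of the event.\<close>

lemma integral_Zcond:
  assumes j: "j < d"
  shows "(\<integral>n. Zcond d lam beta gu A u j n \<partial>gaussN d) = measure (gaussN d) (dominant_event d lam beta gu A u j)"
proof -
  have "ennreal (\<integral>n. Zcond d lam beta gu A u j n \<partial>gaussN d) = (\<integral>\<^sup>+n. ennreal (Zcond d lam beta gu A u j n) \<partial>gaussN d)"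
    using integrable_Zcond_power[OF j, where m = 1] Zcond_bounds by (intro nn_integral_eq_integral[symmetric]) auto
  also have "\<dots> = (\<integral>\<^sup>+n. (\<integral>\<^sup>+t. indicator (dominant_event d lam beta gu A u j) (n(j := t)) \<partial>std_gauss) \<partial>gaussN d)"
    by (intro nn_integral_cong ennreal_Zcond j)
  also have "\<dots> = (\<integral>\<^sup>+n. indicator (dominant_event d lam beta gu A u j) n \<partial>gaussN d)"
    by (intro nn_integral_gaussN_resample j) measurable
  also have "\<dots> = ennreal (measure (gaussN d) (dominant_event d lam beta gu A u j))"
    by (simp add: gaussN.emeasure_eq_measure)
  finally show ?thesis
    by (subst (asm) ennreal_inj) (auto intro!: integral_nonneg_AE Zcond_bounds)
qed

text \<open>The event is the preimage under \<open>A N\<close> of a set \<open>T\<close> that does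
  not involve \<open>A\<close>, so only the law of \<open>A N\<close> matters.\<close>

lemma measure_dominant_event_cong:
  assumes "\<And>i k. i < d \<Longrightarrow> k < d \<Longrightarrow> (\<Sum>l<d. A i l * A k l) = (\<Sum>l<d. B i l * B k l)" and j: "j < d"
  shows "measure (gaussN d) (dominant_event d lam beta gu A u j) = measure (gaussN d) (dominant_event d lam beta gu B u j)"
proof -
  define x where "x i y = lam i * exp (beta i * gu * y i)" for i and y :: "nat \<Rightarrow> real"
  define T where "T = {y \<in> space (PiM {..<d} (\<lambda>_. borel)). (\<Sum>i\<in>{..<d}. x i y) > u \<and> (\<forall>i\<in>{..<d}. x i y \<le> x j y)}"
  have [measurable]: "x i \<in> borel_measurable (PiM {..<d} (\<lambda>_. borel))" if "i \<in> {..<d}" for i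
  proof -
    have [measurable]: "(\<lambda>y. y i) \<in> borel_measurable (PiM {..<d} (\<lambda>_. borel))"
      using that by (rule measurable_component_singleton)
    show ?thesis unfolding x_def by measurable
  qed
  have [measurable]: "x j \<in> borel_measurable (PiM {..<d} (\<lambda>_. borel))" using j by simp
  have [measurable]: "Measurable.pred (PiM {..<d} (\<lambda>_. borel)) (\<lambda>y. x i y \<le> x j y)" if "i \<in> {..<d}" for i
    unfolding pred_def using that j by (intro borel_measurable_le) auto
  have [measurable]: "T \<in> sets (PiM {..<d} (\<lambda>_. borel))"
    unfolding T_def by measurable
  have *: "measure (gaussN d) (dominant_event d lam beta gu A u j)
      = measure (distr (gaussN d) (PiM {..<d} (\<lambda>_. borel)) (\<lambda>n. \<lambda>i\<in>{..<d}. Yv d A n i)) T" for A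
  proof -
    have "dominant_event d lam beta gu A u j = (\<lambda>n. \<lambda>i\<in>{..<d}. Yv d A n i) -` T \<inter> space (gaussN d)"
      using j by (auto simp: dominant_event_def T_def x_def Xv_def Ssum_def space_PiM cong: sum.cong_simp)
    then show ?thesis by (subst measure_distr) auto
  qed
  have "distr (gaussN d) (PiM {..<d} (\<lambda>_. borel)) (\<lambda>n. \<lambda>i\<in>{..<d}. Yv d A n i)
      = distr (gaussN d) (PiM {..<d} (\<lambda>_. borel)) (\<lambda>n. \<lambda>i\<in>{..<d}. Yv d B n i)"
    by (rule distr_Yv_eqI) (rule assms(1))
  then show ?thesis by (simp only: *)
qed

text \<open>After taking logarithms a tie is an affine equation in \<open>n\<close>. The squared
  norm of its normal vector is a value of the positive definite form, so the hyperplane is a null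
  set.\<close>

lemma AE_Xv_distinct:
  assumes pos: "\<And>i. i < d \<Longrightarrow> lam i > 0" "\<And>i. i < d \<Longrightarrow> beta i > 0" "gu > 0"
    and pd: "\<And>x::nat \<Rightarrow> real. \<exists>i<d. x i \<noteq> 0 \<Longrightarrow> (\<Sum>i<d. \<Sum>k<d. x i * (\<Sum>l<d. A i l * A k l) * x k) > 0"
    and i: "i < d" and k: "k < d" and ik: "i \<noteq> k"
  shows "AE n in gaussN d. Xv d lam beta gu A n i \<noteq> Xv d lam beta gu A n k"
proof -
  \<comment> \<open>With this \<open>x\<close>, the sum of \<open>x m * Y_m\<close> is
    \<open>ln X_i - ln X_k\<close> up to the constant \<open>b\<close>.\<close>
  define x where "x = (\<lambda>_::nat. 0::real)(i := beta i * gu, k := - (beta k * gu))"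
  have x: "(\<Sum>m<d. x m * f m) = beta i * gu * f i - beta k * gu * f k" for f :: "nat \<Rightarrow> real"
  proof -
    have "(\<Sum>m<d. x m * f m) = (\<Sum>m<d. (if m = i then beta i * gu * f i else 0) - (if m = k then beta k * gu * f k else 0))"
      using ik by (intro sum.cong) (auto simp: x_def)
    then show ?thesis using i k by (simp add: sum_subtractf)
  qed
  define c where "c l = (\<Sum>m<d. x m * A m l)" for l
  define b where "b = ln (lam k) - ln (lam i)"
  have "\<exists>i<d. x i \<noteq> 0" using i ik pos(2)[OF i] pos(3) by (intro exI[of _ i]) (auto simp: x_def)
  then have "(\<Sum>l<d. (c l)\<^sup>2) > 0"
    unfolding c_def sum_square_linear_comb by (rule pd)
  then have "measure (gaussN d) {n \<in> space (gaussN d). (\<Sum>l<d. c l * n l) = b} = 0"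
    by (rule measure_gaussN_hyperplane)
  moreover have "{n \<in> space (gaussN d). (\<Sum>l<d. c l * n l) = b} \<in> sets (gaussN d)"
    by measurable
  ultimately have "AE n in gaussN d. n \<notin> {n \<in> space (gaussN d). (\<Sum>l<d. c l * n l) = b}"
    by (intro AE_not_in null_setsI) (auto simp: gaussN.emeasure_eq_measure)
  then show ?thesis
    using AE_space
  proof eventually_elim
    case (elim n)
    show ?case
    proof
      assume "Xv d lam beta gu A n i = Xv d lam beta gu A n k"
      then have "ln (lam i * exp (beta i * gu * Yv d A n i)) = ln (lam k * exp (beta k * gu * Yv d A n k))"
        by (simp add: Xv_def)
      then have "beta i * gu * Yv d A n i - beta k * gu * Yv d A n k = b"
        using pos(1)[OF i] pos(1)[OF k] by (simp add: b_def ln_mult)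
      then have "(\<Sum>l<d. c l * n l) = b"
        using sum_Yv[where m = d and d = d and c = x and A = A and n = n] by (simp add: c_def x)
      then show False using elim by simp
    qed
  qed
qed

text \<open>Each expectation is the probability that summand \<open>i\<close> dominates. With all of
  these computed from the single matrix \<open>A j\<close>, the events partition the event that the
  sum exceeds \<open>u\<close>, up to ties.\<close>

proposition sum_integral_Zcond:
  assumes pos: "\<And>i. i < d \<Longrightarrow> lam i > 0" "\<And>i. i < d \<Longrightarrow> beta i > 0" "gu > 0"
    and d: "d > 0"
    and pd: "\<And>x::nat \<Rightarrow> real. \<exists>i<d. x i \<noteq> 0 \<Longrightarrow> (\<Sum>i<d. \<Sum>k<d. x i * \<sigma> i k * x k) > 0"
    and fact: "\<And>j i k. j < d \<Longrightarrow> i < d \<Longrightarrow> k < d \<Longrightarrow> (\<Sum>l<d. A j i l * A j k l) = \<sigma> i k"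
    and j: "j < d"
  shows "(\<Sum>i<d. \<integral>n. Zcond d lam beta gu (A i) u i n \<partial>gaussN d) = alpha_j d lam beta gu (A j) u"
proof -
  have "(\<Sum>i<d. \<integral>n. Zcond d lam beta gu (A i) u i n \<partial>gaussN d)
     = (\<Sum>i<d. measure (gaussN d) (dominant_event d lam beta gu (A i) u i))"
    by (simp add: integral_Zcond)
  also have "\<dots> = (\<Sum>i<d. measure (gaussN d) (dominant_event d lam beta gu (A j) u i))"
  proof (rule sum.cong[OF refl])
    fix m assume "m \<in> {..<d}"
    then have m: "m < d" by simp
    show "measure (gaussN d) (dominant_event d lam beta gu (A m) u m) = measure (gaussN d) (dominant_event d lam beta gu (A j) u m)"
      by (rule measure_dominant_event_cong[OF _ m]) (simp only: fact[OF m] fact[OF j])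
  qed
  also have "\<dots> = measure (gaussN d) {n \<in> space (gaussN d). Ssum d lam beta gu (A j) n > u}"
    unfolding dominant_event_def
  proof (rule gaussN.prob_sum[symmetric])
    show "{n \<in> space (gaussN d). u < Ssum d lam beta gu (A j) n \<and>
        (\<forall>i<d. Xv d lam beta gu (A j) n i \<le> Xv d lam beta gu (A j) n m)} \<in> sets (gaussN d)" for m
      by (rule sets_dominant_event[unfolded dominant_event_def])
    have pd': "(\<Sum>i<d. \<Sum>k<d. x i * (\<Sum>l<d. A j i l * A j k l) * x k) > 0" if "\<exists>i<d. x i \<noteq> 0" for x :: "nat \<Rightarrow> real"
    proof -
      have "(\<Sum>i<d. \<Sum>k<d. x i * (\<Sum>l<d. A j i l * A j k l) * x k) = (\<Sum>i<d. \<Sum>k<d. x i * \<sigma> i k * x k)"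
      proof (intro sum.cong[OF refl])
        fix i k assume "i \<in> {..<d}" "k \<in> {..<d}"
        then show "x i * (\<Sum>l<d. A j i l * A j k l) * x k = x i * \<sigma> i k * x k"
          using fact[OF j, of i k] by simp
      qed
      then show ?thesis using pd[OF that] by simp
    qed
    \<comment> \<open>Without ties the maximum is attained at exactly one index, which is the
      uniqueness that \<open>prob_sum\<close> demands.\<close>
    have "AE n in gaussN d. \<forall>i\<in>{..<d}. \<forall>k\<in>{..<d}. i \<noteq> k \<longrightarrow> Xv d lam beta gu (A j) n i \<noteq> Xv d lam beta gu (A j) n k"
      by (intro AE_finite_allI AE_impI finite_lessThan AE_Xv_distinct[OF pos pd']) (assumption | simp)+
    then show "AE n in gaussN d. (\<forall>m\<in>{..<d}. u < Ssum d lam beta gu (A j) n \<and>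
          (\<forall>i<d. Xv d lam beta gu (A j) n i \<le> Xv d lam beta gu (A j) n m) \<longrightarrow> u < Ssum d lam beta gu (A j) n) \<and>
       (u < Ssum d lam beta gu (A j) n \<longrightarrow> (\<exists>!m\<in>{..<d}. u < Ssum d lam beta gu (A j) n \<and>
          (\<forall>i<d. Xv d lam beta gu (A j) n i \<le> Xv d lam beta gu (A j) n m)))"
    proof eventually_elim
      case (elim n)
      let ?x = "Xv d lam beta gu (A j) n"
      have "Max (?x ` {..<d}) \<in> ?x ` {..<d}"
        using d by (intro Max_in) auto
      then obtain m where m: "m < d" "Max (?x ` {..<d}) = ?x m" by auto
      have max: "?x i \<le> ?x m" if "i < d" for i
        using that unfolding m(2)[symmetric] by (intro Max_ge) auto
      have "m' = m" if "m' < d" "\<forall>i<d. ?x i \<le> ?x m'" for m'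
      proof (rule ccontr)
        assume "m' \<noteq> m"
        then have "?x m' \<noteq> ?x m" using elim that(1) m(1) by blast
        moreover have "?x m \<le> ?x m'" "?x m' \<le> ?x m" using that m(1) max by blast+
        ultimately show False by simp
      qed
      then have "\<exists>!m. m \<in> {..<d} \<and> (\<forall>i<d. ?x i \<le> ?x m)"
        using m(1) max by (intro ex1I[of _ m]) blast+
      then show ?case by blast
    qed
    show "{n \<in> space (gaussN d). u < Ssum d lam beta gu (A j) n} \<in> sets (gaussN d)"
      by measurable
  qed simp
  finally show ?thesis by (simp add: alpha_j_def)
qed

section \<open>Expectations under the joint law of the Gaussian vector and the random index\<close>

lemma
  assumes p: "\<And>i. i < d \<Longrightarrow> ptail lam beta gu u i > 0" and d: "d > 0"
  shows prob_space_jointNI: "prob_space (jointNI d lam beta gu u)"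
    and integral_jointNI: "\<And>F. F \<in> borel_measurable (jointNI d lam beta gu u) \<Longrightarrow> (\<And>\<omega>. \<bar>F \<omega>\<bar> \<le> C) \<Longrightarrow>
      integral\<^sup>L (jointNI d lam beta gu u) F =
      (\<Sum>i<d. ptail lam beta gu u i / (\<Sum>k<d. ptail lam beta gu u k) * (\<integral>n. F (n, i) \<partial>gaussN d))"
proof -
  let ?P = "\<Sum>k<d. ptail lam beta gu u k"
  have P: "?P > 0" using p d by (intro sum_pos) auto
  have q: "0 \<le> ptail lam beta gu u i / ?P" if "i < d" for i using p[OF that] P by simp
  have "emeasure (index_law d lam beta gu u) {..<d} = (\<Sum>i<d. ennreal (ptail lam beta gu u i / ?P))"
    unfolding index_law_def
    by (subst emeasure_density) (auto simp: nn_integral_count_space_finite)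
  also have "\<dots> = 1"
    using P by (subst sum_ennreal) (auto intro: q simp flip: sum_divide_distrib)
  finally have "prob_space (index_law d lam beta gu u)"
    by (intro prob_spaceI) (simp add: index_law_def)
  then interpret I: prob_space "index_law d lam beta gu u" .
  interpret P: pair_prob_space "gaussN d" "index_law d lam beta gu u" ..
  show "prob_space (jointNI d lam beta gu u)"
    unfolding jointNI_def by (rule P.prob_space_axioms)
  fix F assume F: "F \<in> borel_measurable (jointNI d lam beta gu u)" "\<And>\<omega>. \<bar>F \<omega>\<bar> \<le> C"
  have [measurable]: "F \<in> borel_measurable (gaussN d \<Otimes>\<^sub>M index_law d lam beta gu u)"
    using F(1) by (simp add: jointNI_def)
  have "integrable (jointNI d lam beta gu u) F"
    unfolding jointNI_def using F(2) by (intro P.integrable_const_bound[where B = C]) auto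
  then have "integral\<^sup>L (jointNI d lam beta gu u) F = (\<integral>n. (\<integral>i. F (n, i) \<partial>index_law d lam beta gu u) \<partial>gaussN d)"
    unfolding jointNI_def by (rule P.integral_fst'[symmetric])
  \<comment> \<open>By definition \<open>index_law\<close> is a point measure on \<open>d\<close>
    indices, so the inner integral is a finite weighted sum.\<close>
  also have "\<dots> = (\<integral>n. (\<Sum>i<d. ptail lam beta gu u i / ?P * F (n, i)) \<partial>gaussN d)"
  proof (intro Bochner_Integration.integral_cong refl)
    fix n
    have "(\<integral>i. F (n, i) \<partial>point_measure {..<d} (\<lambda>i. ennreal (ptail lam beta gu u i / ?P)))
       = (\<Sum>i<d. (ptail lam beta gu u i / ?P) *\<^sub>R F (n, i))"
      by (rule lebesgue_integral_point_measure_finite) (auto intro: q)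
    then show "(\<integral>i. F (n, i) \<partial>index_law d lam beta gu u) = (\<Sum>i<d. ptail lam beta gu u i / ?P * F (n, i))"
      by (simp only: point_measure_def index_law_def real_scaleR_def)
  qed
  also have "\<dots> = (\<Sum>i<d. \<integral>n. ptail lam beta gu u i / ?P * F (n, i) \<partial>gaussN d)"
  proof (intro Bochner_Integration.integral_sum integrable_mult_right)
    fix i assume "i \<in> {..<d}"
    then have [measurable]: "(\<lambda>n. (n, i)) \<in> gaussN d \<rightarrow>\<^sub>M gaussN d \<Otimes>\<^sub>M index_law d lam beta gu u"
      by (intro measurable_Pair) (auto simp: index_law_def)
    show "integrable (gaussN d) (\<lambda>n. F (n, i))"
      using F(2) by (intro gaussN.integrable_const_bound[where B = C]) auto
  qed
  finally show "integral\<^sup>L (jointNI d lam beta gu u) F =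
      (\<Sum>i<d. ptail lam beta gu u i / ?P * (\<integral>n. F (n, i) \<partial>gaussN d))" by simp
qed

lemma measurable_Z_MAK: "Z_MAK d lam beta gu A u \<in> borel_measurable (jointNI d lam beta gu u)"
proof -
  have [measurable]: "(\<lambda>\<omega>. Zcond d lam beta gu (A i) u i (fst \<omega>)) \<in> borel_measurable (jointNI d lam beta gu u)"
    if "i \<in> {..<d}" for i
    using that unfolding jointNI_def by (intro measurable_compose[OF measurable_fst] measurable_Zcond) auto
  have [measurable]: "snd \<in> jointNI d lam beta gu u \<rightarrow>\<^sub>M count_space UNIV"
    unfolding jointNI_def by (rule measurable_compose[OF measurable_snd]) (simp add: index_law_def)
  show ?thesis unfolding Z_MAK_def[abs_def] by measurable
qed

lemma Z_MAK_Pair: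
  assumes "i < d"
  shows "Z_MAK d lam beta gu A u (n, i) =
    (\<Sum>k<d. ptail lam beta gu u k) / ptail lam beta gu u i * Zcond d lam beta gu (A i) u i n"
proof -
  have "(\<Sum>k<d. (if i = k then 1 else 0) * Zcond d lam beta gu (A k) u k n / ptail lam beta gu u k)
     = (\<Sum>k<d. if k = i then Zcond d lam beta gu (A i) u i n / ptail lam beta gu u i else 0)"
    by (intro sum.cong) auto
  then show ?thesis using assms by (simp add: Z_MAK_def)
qed

text \<open>The index probability \<open>p_i / P\<close> cancels one factor \<open>P / p_i\<close>
  of the estimator. The first moment is left with the bare \<open>Z_i\<close>, the second with
  \<open>P / p_i\<close> times the square of \<open>Z_i\<close>.\<close>

lemma
  assumes p: "\<And>i. i < d \<Longrightarrow> ptail lam beta gu u i > 0" and d: "d > 0"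
  shows Z_MAK_bounded: "\<exists>C. \<forall>\<omega>. \<bar>Z_MAK d lam beta gu A u \<omega>\<bar> \<le> C"
    and integral_Z_MAK: "integral\<^sup>L (jointNI d lam beta gu u) (Z_MAK d lam beta gu A u)
      = (\<Sum>i<d. \<integral>n. Zcond d lam beta gu (A i) u i n \<partial>gaussN d)"
    and integral_Z_MAK_square: "integral\<^sup>L (jointNI d lam beta gu u) (\<lambda>\<omega>. (Z_MAK d lam beta gu A u \<omega>)\<^sup>2)
      = (\<Sum>k<d. ptail lam beta gu u k) *
        (\<Sum>i<d. (\<integral>n. (Zcond d lam beta gu (A i) u i n)\<^sup>2 \<partial>gaussN d) / ptail lam beta gu u i)"
proof -
  let ?p = "ptail lam beta gu u"
  let ?P = "\<Sum>k<d. ?p k"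
  have P: "?P > 0" using p d by (intro sum_pos) auto
  define C where "C = ?P * (\<Sum>i<d. 1 / ?p i)"
  have bd: "\<bar>Z_MAK d lam beta gu A u \<omega>\<bar> \<le> C" for \<omega>
  proof -
    have "\<bar>\<Sum>i<d. (if snd \<omega> = i then 1 else 0) * Zcond d lam beta gu (A i) u i (fst \<omega>) / ?p i\<bar> \<le> (\<Sum>i<d. 1 / ?p i)"
    proof (rule order_trans[OF sum_abs sum_mono])
      fix i assume "i \<in> {..<d}"
      then have "?p i > 0" using p by auto
      then show "\<bar>(if snd \<omega> = i then 1 else 0) * Zcond d lam beta gu (A i) u i (fst \<omega>) / ?p i\<bar> \<le> 1 / ?p i"
        using Zcond_bounds[of d lam beta gu "A i" u i "fst \<omega>"] by (auto simp: field_simps)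
    qed
    then show ?thesis
      unfolding Z_MAK_def C_def using P by (simp add: abs_mult)
  qed
  then show "\<exists>C. \<forall>\<omega>. \<bar>Z_MAK d lam beta gu A u \<omega>\<bar> \<le> C" by blast
  have p0: "?p i \<noteq> 0" if "i < d" for i using p[OF that] by simp
  show "integral\<^sup>L (jointNI d lam beta gu u) (Z_MAK d lam beta gu A u)
      = (\<Sum>i<d. \<integral>n. Zcond d lam beta gu (A i) u i n \<partial>gaussN d)"
    using P p0 by (subst integral_jointNI[OF p d measurable_Z_MAK bd]) (auto simp: Z_MAK_Pair intro!: sum.cong)
  have [measurable]: "(\<lambda>\<omega>. (Z_MAK d lam beta gu A u \<omega>)\<^sup>2) \<in> borel_measurable (jointNI d lam beta gu u)"
    using measurable_Z_MAK by measurable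
  have bd2: "\<bar>(Z_MAK d lam beta gu A u \<omega>)\<^sup>2\<bar> \<le> C\<^sup>2" for \<omega>
    using power_mono[OF bd[of \<omega>], of 2] by simp
  have "integral\<^sup>L (jointNI d lam beta gu u) (\<lambda>\<omega>. (Z_MAK d lam beta gu A u \<omega>)\<^sup>2)
      = (\<Sum>i<d. ?p i / ?P * ((?P / ?p i)\<^sup>2 * (\<integral>n. (Zcond d lam beta gu (A i) u i n)\<^sup>2 \<partial>gaussN d)))"
  proof -
    have "(\<integral>n. (Z_MAK d lam beta gu A u (n, i))\<^sup>2 \<partial>gaussN d)
        = (?P / ?p i)\<^sup>2 * (\<integral>n. (Zcond d lam beta gu (A i) u i n)\<^sup>2 \<partial>gaussN d)" if "i < d" for i
      by (simp only: Z_MAK_Pair[OF that] power_mult_distrib integral_mult_right_zero)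
    then show ?thesis by (subst integral_jointNI[OF p d _ bd2]) auto
  qed
  also have "\<dots> = (\<Sum>i<d. ?P * ((\<integral>n. (Zcond d lam beta gu (A i) u i n)\<^sup>2 \<partial>gaussN d) / ?p i))"
    using P p0 by (intro sum.cong) (auto simp: power2_eq_square field_simps)
  finally show "integral\<^sup>L (jointNI d lam beta gu u) (\<lambda>\<omega>. (Z_MAK d lam beta gu A u \<omega>)\<^sup>2)
      = ?P * (\<Sum>i<d. (\<integral>n. (Zcond d lam beta gu (A i) u i n)\<^sup>2 \<partial>gaussN d) / ?p i)"
    by (simp add: sum_distrib_left)
qed

section \<open>Asymptotics\<close>

context
  fixes d :: nat and lam beta :: "nat \<Rightarrow> real" and \<gamma> :: real and g :: "real \<Rightarrow> real"
  assumes lam_pos: "\<And>i. i < d \<Longrightarrow> lam i > 0" and beta_pos: "\<And>i. i < d \<Longrightarrow> beta i > 0"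
    and g_pos: "\<And>u. u > 0 \<Longrightarrow> g u > 0" and g_lim: "(g \<longlongrightarrow> \<gamma>) at_top" and gamma_pos: "\<gamma> > 0"
begin

lemma inverse_rate_limit:
  assumes j: "j < d"
  shows "((\<lambda>u. 1 / (beta j * g u)) \<longlongrightarrow> 1 / (beta j * \<gamma>)) at_top"
  using gamma_pos beta_pos[OF j] by (auto intro!: tendsto_eq_intros g_lim)

lemma level_rate:
  assumes j: "j < d"
  shows "((\<lambda>u. level lam beta (g u) u j / ln u) \<longlongrightarrow> 1 / (beta j * \<gamma>)) at_top"
proof (rule Lim_transform_eventually)
  have "((\<lambda>u. (ln u - ln (lam j)) / ln u) \<longlongrightarrow> 1) at_top" by real_asymp
  from tendsto_mult[OF this inverse_rate_limit[OF j]]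
  show "((\<lambda>u. (ln u - ln (lam j)) / ln u * (1 / (beta j * g u))) \<longlongrightarrow> 1 / (beta j * \<gamma>)) at_top"
    by simp
  show "eventually (\<lambda>u. (ln u - ln (lam j)) / ln u * (1 / (beta j * g u)) = level lam beta (g u) u j / ln u) at_top"
    using eventually_gt_at_top[of "0::real"] by eventually_elim (use lam_pos[OF j] in \<open>simp add: level_def ln_div\<close>)
qed

lemma shift_limit:
  assumes j: "j < d"
  shows "((\<lambda>u. ln (real d) / (beta j * g u)) \<longlongrightarrow> ln (real d) / (beta j * \<gamma>)) at_top"
  using tendsto_mult[OF tendsto_const inverse_rate_limit[OF j], of "ln (real d)"] by simp

lemma level_at_top:
  assumes j: "j < d"
  shows "filterlim (\<lambda>u. level lam beta (g u) u j) at_top at_top"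
proof -
  have "filterlim (\<lambda>u. level lam beta (g u) u j / ln u * ln u) at_top at_top"
    using level_rate[OF j] gamma_pos beta_pos[OF j] ln_at_top
    by (intro filterlim_tendsto_pos_mult_at_top[where c = "1 / (beta j * \<gamma>)"]) auto
  moreover have "eventually (\<lambda>u. level lam beta (g u) u j / ln u * ln u = level lam beta (g u) u j) at_top"
    using eventually_gt_at_top[of 1] by eventually_elim simp
  ultimately show ?thesis using filterlim_cong by fast
qed

text \<open>A smaller \<open>beta j\<close> means a higher level on the scale \<open>ln u\<close>,
  hence a tail lighter in the leading quadratic exponent. The crude bound \<open>Zcond_le\<close>
  loses only a bounded shift of the level.\<close>

lemma Zcond_moment_negligible:
  assumes j: "j < d" and i: "i < d" and less: "beta j < beta i" and \<eta>: "\<eta> > 0"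
    and row: "\<And>u k. u > 0 \<Longrightarrow> k < d \<Longrightarrow> A u j k = (if k = j then 1 else 0)"
  shows "eventually (\<lambda>u. (\<integral>n. (Zcond d lam beta (g u) (A u) u j n)\<^sup>2 \<partial>gaussN d)
           \<le> \<eta> * gauss_tail (level lam beta (g u) u j) * gauss_tail (level lam beta (g u) u i)
         \<and> gauss_tail (level lam beta (g u) u j) \<le> \<eta> * gauss_tail (level lam beta (g u) u i)) at_top"
proof -
  have "1 / (beta i * \<gamma>) < 1 / (beta j * \<gamma>)" "0 < 1 / (beta i * \<gamma>)"
    using less beta_pos[OF j] beta_pos[OF i] gamma_pos by (auto intro!: divide_strict_left_mono)
  then have "eventually (\<lambda>u. (gauss_tail (level lam beta (g u) u j - ln (real d) / (beta j * g u)))\<^sup>2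
      \<le> \<eta> * gauss_tail (level lam beta (g u) u j) * gauss_tail (level lam beta (g u) u i)) at_top"
    by (intro gauss_tail_lighter_eventually[OF ln_at_top level_rate[OF j] level_rate[OF i] _ _ shift_limit[OF j] \<eta>])
  then show ?thesis
    using eventually_gt_at_top[of "0::real"]
  proof eventually_elim
    case (elim u)
    let ?y = "level lam beta (g u) u j"
    let ?q = "gauss_tail (?y - ln (real d) / (beta j * g u))"
    have Z: "Zcond d lam beta (g u) (A u) u j n \<le> ?q" for n
      using elim j row g_pos lam_pos beta_pos by (intro Zcond_le) auto
    have "(\<integral>n. (Zcond d lam beta (g u) (A u) u j n)\<^sup>2 \<partial>gaussN d) \<le> (\<integral>n. ?q\<^sup>2 \<partial>gaussN d)"
      using Z Zcond_bounds by (intro integral_mono integrable_Zcond_power j power_mono) auto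
    then have "(\<integral>n. (Zcond d lam beta (g u) (A u) u j n)\<^sup>2 \<partial>gaussN d) \<le> ?q\<^sup>2"
      by (simp add: gaussN.prob_space)
    \<comment> \<open>The second claim follows from the first estimate: the tail at
      \<open>?y\<close> is below \<open>?q\<close>, and one positive factor cancels.\<close>
    moreover have "gauss_tail ?y \<le> ?q"
      using j elim beta_pos[OF j] g_pos[of u] by (intro gauss_tail_mono) auto
    then have "(gauss_tail ?y)\<^sup>2 \<le> ?q\<^sup>2" using gauss_tail_nonneg by (intro power_mono) auto
    then have "gauss_tail ?y * gauss_tail ?y \<le> gauss_tail ?y * (\<eta> * gauss_tail (level lam beta (g u) u i))"
      using elim by (simp add: power2_eq_square mult_ac)
    then have "gauss_tail ?y \<le> \<eta> * gauss_tail (level lam beta (g u) u i)"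
      using gauss_tail_pos[of ?y] by simp
    ultimately show ?case using elim by simp
  qed
qed

text \<open>Since row \<open>i\<close> has norm 1, deleting its entry \<open>j\<close> leaves a
  residual of variance \<open>1 - (A i j)^2\<close>.\<close>

lemma measure_residual_tail:
  assumes j: "j < d" and i: "i < d" and unit: "(\<Sum>l<d. (A i l)\<^sup>2) = 1" and r: "r \<ge> 0"
  shows "measure (gaussN d) {n \<in> space (gaussN d). residual d A j i n > r * sqrt (1 - (A i j)\<^sup>2)} \<le> gauss_tail r"
proof -
  have "(\<Sum>k<d. (((A i)(j := 0)) k)\<^sup>2) = (\<Sum>k<d. (A i k)\<^sup>2 - (if k = j then (A i j)\<^sup>2 else 0))"
    by (intro sum.cong) auto
  also have "\<dots> = 1 - (A i j)\<^sup>2" using j unit by (simp add: sum_subtractf)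
  finally show ?thesis
    using measure_gaussN_linear_tail[OF r, of d "(A i)(j := 0)"]
    by (simp only: residual_def gauss_tail_def)
qed

lemma measurable_residual [measurable]: "residual d A j i \<in> borel_measurable (gaussN d)"
  unfolding residual_def[abs_def] by measurable

text \<open>Outside the event \<open>Bad\<close> of a large residual, \<open>Z_j\<close> lies
  between the tail and \<open>q\<close> times the tail. On \<open>Bad\<close> the crude bound is
  paid for by the small probability of \<open>Bad\<close>.\<close>

lemma Zcond_moments_dominant:
  assumes j: "j < d" and beta_le: "\<And>i. i < d \<Longrightarrow> beta i \<le> beta j" and \<eta>: "\<eta> > 0"
    and row: "\<And>u k. u > 0 \<Longrightarrow> k < d \<Longrightarrow> A u j k = (if k = j then 1 else 0)"
    and unit: "\<And>u i. u > 0 \<Longrightarrow> i < d \<Longrightarrow> (\<Sum>l<d. (A u i l)\<^sup>2) = 1"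
    and cond: "\<And>i c \<epsilon>. i < d \<Longrightarrow> i \<noteq> j \<Longrightarrow> c > 0 \<Longrightarrow> \<epsilon> > 0 \<Longrightarrow>
      eventually (\<lambda>u. A u i j + c * sqrt ((1 - (A u i j)\<^sup>2) / ln u)
        \<le> beta j / beta i * (ln (\<epsilon> * e_star lam beta (g u) u i) / ln u)) at_top"
  shows "eventually (\<lambda>u. (\<integral>n. (Zcond d lam beta (g u) (A u) u j n)\<^sup>2 \<partial>gaussN d)
             \<le> (1 + \<eta>) * (gauss_tail (level lam beta (g u) u j))\<^sup>2
         \<and> (1 - \<eta>) * gauss_tail (level lam beta (g u) u j)
             \<le> (\<integral>n. Zcond d lam beta (g u) (A u) u j n \<partial>gaussN d)) at_top"
proof -
  define b where "b = beta j * \<gamma>"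
  have b: "b > 0" using beta_pos[OF j] gamma_pos by (simp add: b_def)
  have d: "real d \<ge> 1" "real d > 0" using j by auto
  define a where "a = 1 / b"
  define h0 where "h0 = ln (real d) / b"
  have ah: "a > 0" "h0 \<ge> 0" using b d by (auto simp: a_def h0_def)
  \<comment> \<open>Chosen so that \<open>K^2 / 2\<close> exceeds \<open>2 * a * h0 + 2 * a\<close>,
    the loss incurred in \<open>gauss_tail_shift_square_eventually\<close>.\<close>
  define K where "K = 2 * sqrt (a * h0 + a) + 1"
  have K: "K > 0" "2 * a * h0 + 2 * a < K\<^sup>2 / 2"
  proof -
    have "a * h0 + a > 0" using ah by (intro add_nonneg_pos mult_nonneg_nonneg) auto
    then have s: "sqrt (a * h0 + a) > 0" "(sqrt (a * h0 + a))\<^sup>2 = a * h0 + a" by auto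
    show "K > 0" unfolding K_def using s(1) by linarith
    have K2: "K\<^sup>2 = 4 * (sqrt (a * h0 + a))\<^sup>2 + 4 * sqrt (a * h0 + a) + 1"
      by (simp add: K_def power2_eq_square algebra_simps)
    have "2 * a * h0 + 2 * a = 2 * (a * h0 + a)" by (simp add: algebra_simps)
    then show "2 * a * h0 + 2 * a < K\<^sup>2 / 2" using K2[unfolded s(2)] s(1) by linarith
  qed
  \<comment> \<open>\<open>q^2\<close> spends half of \<open>\<eta>\<close>; the other half is left
    for \<open>Bad\<close>. \<open>\<kappa>\<close> is half of \<open>ln q\<close>, to have
    \<open>exp \<kappa> < q\<close> strictly.\<close>
  define q where "q = sqrt (1 + \<eta> / 2)"
  have q: "q > 1" "q\<^sup>2 = 1 + \<eta> / 2" using \<eta> by (auto simp: q_def)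
  define \<kappa> where "\<kappa> = ln q / 2"
  have \<kappa>: "\<kappa> > 0" "q > exp \<kappa>"
  proof -
    show "\<kappa> > 0" using q by (simp add: \<kappa>_def)
    then have "exp \<kappa> < exp (ln q)" by (simp add: \<kappa>_def)
    then show "q > exp \<kappa>" using q by simp
  qed
  \<comment> \<open>The level is asymptotic to \<open>ln u / b\<close>, and a relative reduction of
    \<open>u\<close> by \<open>c / ln u\<close> lowers it by about \<open>c / (b * ln u)\<close>.
    The product of the two tends to \<open>c / b^2 = \<kappa>\<close>. Dividing by
    \<open>d^2\<close> in \<open>\<delta>\<close> compensates the factor in
    \<open>Zcond_le_good\<close>.\<close>
  define c where "c = \<kappa> * b\<^sup>2"
  define \<delta> where "\<delta> = c / (real d)\<^sup>2"
  have c: "c > 0" using \<kappa> b by (simp add: c_def)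
  have \<delta>: "\<delta> > 0" "(real d)\<^sup>2 * \<delta> = c" using c d by (auto simp: \<delta>_def)
  have A_le: "\<bar>A u i j\<bar> \<le> 1" if "u > 0" "i < d" for u i
  proof -
    have "(A u i j)\<^sup>2 \<le> (\<Sum>l<d. (A u i l)\<^sup>2)" using j by (intro member_le_sum) auto
    then show ?thesis using unit[OF that] by (simp add: abs_square_le_1)
  qed
  \<comment> \<open>The drop of the level when \<open>u\<close> is replaced by
    \<open>u * (1 - c / ln u)\<close>.\<close>
  define h where "h u = - ln (1 - c / ln u) / (beta j * g u)" for u
  have lev: "((\<lambda>u. level lam beta (g u) u j * h u) \<longlongrightarrow> \<kappa>) at_top"
  proof (rule Lim_transform_eventually)
    have "((\<lambda>u. (ln u - ln (lam j)) * - ln (1 - c / ln u)) \<longlongrightarrow> c) at_top" by real_asymp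
    from tendsto_mult[OF this tendsto_power[OF inverse_rate_limit[OF j], of 2]]
    show "((\<lambda>u. (ln u - ln (lam j)) * - ln (1 - c / ln u) * (1 / (beta j * g u))\<^sup>2) \<longlongrightarrow> \<kappa>) at_top"
      using b by (simp add: c_def b_def[symmetric] power_divide)
    show "eventually (\<lambda>u. (ln u - ln (lam j)) * - ln (1 - c / ln u) * (1 / (beta j * g u))\<^sup>2
        = level lam beta (g u) u j * h u) at_top"
      using eventually_gt_at_top[of "0::real"] by eventually_elim (use lam_pos[OF j] in \<open>simp add: level_def h_def ln_div power2_eq_square\<close>)
  qed
  have E1: "eventually (\<lambda>u. gauss_tail (level lam beta (g u) u j - h u) \<le> q * gauss_tail (level lam beta (g u) u j)) at_top"
    by (rule gauss_tail_shift_eventually[OF level_at_top[OF j] lev \<kappa>(2)])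
  \<comment> \<open>The denominator \<open>d\<close> anticipates the union bound over the
    residuals.\<close>
  have E2: "eventually (\<lambda>u. gauss_tail (K * sqrt (ln u)) * (gauss_tail (level lam beta (g u) u j - ln (real d) / (beta j * g u)))\<^sup>2
      \<le> \<eta> / (2 * d) * (gauss_tail (level lam beta (g u) u j))\<^sup>2) at_top"
    using level_rate[OF j] ah(1) shift_limit[OF j] K \<eta> d
    by (intro gauss_tail_shift_square_eventually[OF ln_at_top, where a = a and hl = h0]) (auto simp: a_def h0_def b_def)
  have E3: "eventually (\<lambda>u. \<forall>i\<in>{..<d} - {j}. \<forall>w. w \<le> K * sqrt (ln u) * sqrt (1 - (A u i j)\<^sup>2) \<longrightarrow>
      lam i * exp (beta i * g u * (A u i j * level lam beta (g u) u j + w)) \<le> \<delta> * u / ln u) at_top"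
    unfolding level_def
  proof (intro eventually_ball_finite ballI)
    fix i assume i: "i \<in> {..<d} - {j}"
    show "eventually (\<lambda>u. \<forall>w. w \<le> K * sqrt (ln u) * sqrt (1 - (A u i j)\<^sup>2) \<longrightarrow>
      lam i * exp (beta i * g u * (A u i j * (ln (u / lam j) / (beta j * g u)) + w)) \<le> \<delta> * u / ln u) at_top"
    proof (rule residual_small_imp_Xv_small_eventually[OF _ _ _ _ gamma_pos K(1) \<delta>(1) g_lim])
      show "eventually (\<lambda>u. \<bar>A u i j\<bar> \<le> 1) at_top"
        using eventually_gt_at_top[of "0::real"] by eventually_elim (use A_le i in auto)
      show "eventually (\<lambda>u. A u i j + c * sqrt ((1 - (A u i j)\<^sup>2) / ln u)
        \<le> beta j / beta i * (ln (\<epsilon> * ((beta i * g u)\<^sup>2 * u / ln (u / lam i))) / ln u)) at_top"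
        if "c > 0" "\<epsilon> > 0" for c \<epsilon>
        using cond[of i c \<epsilon>] that i by (simp add: e_star_def)
    qed (use i j lam_pos beta_pos in auto)
  qed simp
  have "eventually (\<lambda>u. ln u > max c \<delta>) at_top"
    using filterlim_at_top_dense[of "ln :: real \<Rightarrow> real"] ln_at_top by blast
  with E1 E2 E3 eventually_gt_at_top[of "1::real"] show ?thesis
  proof eventually_elim
    case (elim u)
    let ?L = "ln u" and ?Z = "Zcond d lam beta (g u) (A u) u j"
    let ?y = "level lam beta (g u) u j"
    let ?p = "gauss_tail ?y" and ?q = "gauss_tail (?y - ln (real d) / (beta j * g u))"
    let ?t = "gauss_tail (K * sqrt ?L)"
    have u: "u > 0" "?L > 0" using elim by auto
    note pos = lam_pos beta_pos g_pos[OF u(1)] u(1) j row[OF u(1)]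
    define bad where "bad i = {n \<in> space (gaussN d). residual d (A u) j i n > K * sqrt ?L * sqrt (1 - (A u i j)\<^sup>2)}" for i
    define Bad where "Bad = (\<Union>i\<in>{..<d} - {j}. bad i)"
    have [measurable]: "bad i \<in> sets (gaussN d)" for i unfolding bad_def by measurable
    have [measurable]: "Bad \<in> sets (gaussN d)" unfolding Bad_def by (intro sets.finite_UN) auto
    have Bad: "measure (gaussN d) Bad \<le> d * ?t"
    proof -
      have "measure (gaussN d) Bad \<le> (\<Sum>i\<in>{..<d} - {j}. measure (gaussN d) (bad i))"
        unfolding Bad_def by (intro gaussN.finite_measure_subadditive_finite) auto
      also have "\<dots> \<le> (\<Sum>i\<in>{..<d} - {j}. ?t)"
        unfolding bad_def using u K j by (intro sum_mono measure_residual_tail unit) auto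
      also have "\<dots> \<le> (\<Sum>i\<in>{..<d}. ?t)" using gauss_tail_nonneg by (intro sum_mono2) auto
      finally show ?thesis by simp
    qed
    have small: "lam i * exp (beta i * g u * (A u i j * ?y + residual d (A u) j i n)) \<le> \<delta> * u / ?L"
      if "n \<in> space (gaussN d)" "n \<notin> Bad" "i < d" "i \<noteq> j" for n i
    proof -
      have "residual d (A u) j i n \<le> K * sqrt ?L * sqrt (1 - (A u i j)\<^sup>2)"
        using that by (auto simp: Bad_def bad_def not_less)
      then show ?thesis using elim(3) that by auto
    qed
    have dr: "(real d)\<^sup>2 * (\<delta> * u / ?L) = c / ?L * u" by (simp add: \<delta>(2)[symmetric] mult.assoc)
    have "c / ?L < 1" using elim(5) u by simp
    have r: "0 \<le> \<delta> * u / ?L" "(real d)\<^sup>2 * (\<delta> * u / ?L) < u" "\<delta> * u / ?L \<le> u"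
    proof -
      show "0 \<le> \<delta> * u / ?L" using \<delta> u by simp
      note dr
      also have "c / ?L * u < 1 * u" using \<open>c / ?L < 1\<close> u by (intro mult_strict_right_mono) auto
      finally show "(real d)\<^sup>2 * (\<delta> * u / ?L) < u" by simp
      show "\<delta> * u / ?L \<le> u" using elim(5) u by (simp add: field_simps)
    qed
    have lvl: "ln ((u - (real d)\<^sup>2 * (\<delta> * u / ?L)) / lam j) / (beta j * g u) = ?y - h u"
    proof -
      have "u - (real d)\<^sup>2 * (\<delta> * u / ?L) = u * (1 - c / ?L)"
        unfolding dr by (simp add: algebra_simps)
      then have "ln ((u - (real d)\<^sup>2 * (\<delta> * u / ?L)) / lam j) = ln (u / lam j * (1 - c / ?L))" by simp
      also have "\<dots> = ln (u / lam j) + ln (1 - c / ?L)"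
        using u lam_pos[OF j] \<open>c / ?L < 1\<close> by (intro ln_mult_pos) auto
      finally show ?thesis by (simp add: level_def h_def add_divide_distrib)
    qed
    have good_le: "?Z n \<le> q * ?p" if "n \<in> space (gaussN d)" "n \<notin> Bad" for n
    proof -
      have "?Z n \<le> gauss_tail (ln ((u - (real d)\<^sup>2 * (\<delta> * u / ?L)) / lam j) / (beta j * g u))"
        using small[OF that] A_le[OF u(1)] r by (intro Zcond_le_good pos beta_le) auto
      then show ?thesis unfolding lvl using elim(1) by simp
    qed
    have good_ge: "?p \<le> ?Z n" if "n \<in> space (gaussN d)" "n \<notin> Bad" for n
      using small[OF that] A_le[OF u(1)] r by (intro Zcond_ge_good[where r = "\<delta> * u / ?L"] pos beta_le) auto
    have le: "?Z n \<le> ?q" for n by (intro Zcond_le pos)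
    have int: "integrable (gaussN d) (indicat_real Bad)"
      by (intro gaussN.integrable_const_bound[where B = 1]) auto
    \<comment> \<open>Since \<open>?p\<close> is at most \<open>?q\<close>, the second-moment
      estimate also bounds the tail \<open>?t\<close> itself, which is what the first moment
      needs.\<close>
    have "?p \<le> ?q" using d beta_pos[OF j] g_pos[OF u(1)] by (intro gauss_tail_mono) auto
    then have "?p\<^sup>2 \<le> ?q\<^sup>2" using gauss_tail_nonneg by (intro power_mono) auto
    then have "?t * ?q\<^sup>2 \<le> \<eta> / (2 * d) * ?q\<^sup>2"
      using elim(2) mult_left_mono[of "?p\<^sup>2" "?q\<^sup>2" "\<eta> / (2 * d)"] \<eta> by simp
    then have t: "?t \<le> \<eta> / (2 * d)"
      by (rule mult_right_le_imp_le) (intro zero_less_power gauss_tail_pos)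
    have "(\<integral>n. (?Z n)\<^sup>2 \<partial>gaussN d) \<le> (\<integral>n. (q * ?p)\<^sup>2 + indicator Bad n * ?q\<^sup>2 \<partial>gaussN d)"
    proof (rule integral_mono)
      fix n assume n: "n \<in> space (gaussN d)"
      show "(?Z n)\<^sup>2 \<le> (q * ?p)\<^sup>2 + indicator Bad n * ?q\<^sup>2"
      proof (cases "n \<in> Bad")
        case True
        then show ?thesis
          using power_mono[OF le[of n] Zcond_bounds(1), of 2] by (simp add: add_increasing)
      next
        case False
        then show ?thesis using power_mono[OF good_le[OF n] Zcond_bounds(1), of 2] by simp
      qed
    qed (use int j in \<open>auto intro!: integrable_Zcond_power\<close>)
    also have "\<dots> = (q * ?p)\<^sup>2 + measure (gaussN d) Bad * ?q\<^sup>2"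
      using int by (simp add: gaussN.prob_space)
    also have "\<dots> \<le> (q * ?p)\<^sup>2 + d * ?t * ?q\<^sup>2"
      using Bad by (intro add_left_mono mult_right_mono) auto
    also have "d * ?t * ?q\<^sup>2 \<le> d * (\<eta> / (2 * d) * ?p\<^sup>2)"
      using elim(2) by (simp only: mult.assoc) (intro mult_left_mono, auto)
    also have "(q * ?p)\<^sup>2 + d * (\<eta> / (2 * d) * ?p\<^sup>2) = (1 + \<eta>) * ?p\<^sup>2"
      using d by (simp add: power_mult_distrib q(2) field_simps)
    finally have 1: "(\<integral>n. (?Z n)\<^sup>2 \<partial>gaussN d) \<le> (1 + \<eta>) * ?p\<^sup>2" by simp
    \<comment> \<open>For the lower bound \<open>Z_j\<close> is simply discarded on
      \<open>Bad\<close>.\<close>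
    have "(1 - \<eta>) * ?p \<le> (1 - d * ?t) * ?p"
      using t d \<eta> gauss_tail_nonneg[of ?y] by (intro mult_right_mono) (auto simp: field_simps)
    also have "\<dots> \<le> (1 - measure (gaussN d) Bad) * ?p"
      using Bad gauss_tail_nonneg[of ?y] by (intro mult_right_mono) auto
    also have "\<dots> = (\<integral>n. (1 - indicator Bad n) * ?p \<partial>gaussN d)"
      using int by (simp add: gaussN.prob_space)
    also have "\<dots> \<le> (\<integral>n. ?Z n \<partial>gaussN d)"
    proof (rule integral_mono)
      show "(1 - indicator Bad n) * ?p \<le> ?Z n" if "n \<in> space (gaussN d)" for n
        using good_ge[OF that] Zcond_bounds(1)[of d lam beta "g u" "A u" u j n] by (cases "n \<in> Bad") auto
      show "integrable (gaussN d) ?Z" using integrable_Zcond_power[OF j, where m = 1] by simp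
    qed (use int in auto)
    finally show ?case using 1 by simp
  qed
qed

end

text \<open>The algebra of the conclusion: \<open>p\<close> stands for the tails, \<open>m\<close>
  and \<open>z\<close> for the first and second moments of the \<open>Z_i\<close>. Indices outside
  \<open>J\<close> add at most \<open>d * \<eta> * P\<close> to either sum, where \<open>P\<close>
  is the sum of \<open>p\<close> over \<open>J\<close>. The bound tends to 1 with
  \<open>\<eta>\<close>.\<close>

lemma second_moment_ratio_le:
  fixes p z m :: "nat \<Rightarrow> real" and \<eta> :: real
  assumes J: "J \<subseteq> {..<d}" and j0: "j0 \<in> J" and \<eta>: "0 < \<eta>" "\<eta> < 1"
    and p: "\<And>i. i < d \<Longrightarrow> p i > 0" and m: "\<And>i. i < d \<Longrightarrow> m i \<ge> 0"
    and dom: "\<And>j. j \<in> J \<Longrightarrow> z j \<le> (1 + \<eta>) * (p j)\<^sup>2 \<and> (1 - \<eta>) * p j \<le> m j"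
    and neg: "\<And>j. j \<in> {..<d} - J \<Longrightarrow> z j \<le> \<eta> * p j * p j0 \<and> p j \<le> \<eta> * p j0"
  shows "0 < (\<Sum>i<d. m i)"
    and "(\<Sum>i<d. p i) * (\<Sum>i<d. z i / p i) / (\<Sum>i<d. m i)\<^sup>2
      \<le> (1 + d * \<eta>) * (1 + \<eta> + d * \<eta>) / (1 - \<eta>)\<^sup>2"
proof -
  define P where "P = (\<Sum>j\<in>J. p j)"
  have fin: "finite J" using J finite_subset by auto
  have pJ: "p j > 0" if "j \<in> J" for j using that J p by auto
  have P_ge: "p j0 \<le> P" unfolding P_def using fin j0 pJ by (intro member_le_sum) (auto intro: less_imp_le)
  have P: "P > 0" using P_ge pJ[OF j0] by simp
  have split: "(\<Sum>i<d. f i) = (\<Sum>i\<in>J. f i) + (\<Sum>i\<in>{..<d} - J. f i)" for f :: "nat \<Rightarrow> real"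
    using J by (metis add.commute finite_lessThan sum.subset_diff)
  have rest: "(\<Sum>i\<in>{..<d} - J. f i) \<le> d * \<eta> * P" if "\<And>i. i \<in> {..<d} - J \<Longrightarrow> f i \<le> \<eta> * p j0" for f :: "nat \<Rightarrow> real"
  proof -
    have "(\<Sum>i\<in>{..<d} - J. f i) \<le> (\<Sum>i\<in>{..<d} - J. \<eta> * P)"
      using that P_ge \<eta> by (intro sum_mono) (meson less_imp_le mult_left_mono order_trans)
    also have "\<dots> \<le> (\<Sum>i\<in>{..<d}. \<eta> * P)" using \<eta> P by (intro sum_mono2) auto
    finally show ?thesis by simp
  qed
  have 1: "(\<Sum>i<d. p i) \<le> (1 + d * \<eta>) * P"
    using split[of p] rest[of p] neg by (simp add: P_def[symmetric] algebra_simps)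
  have "(\<Sum>i\<in>J. z i / p i) \<le> (\<Sum>i\<in>J. (1 + \<eta>) * p i)"
    using dom pJ by (intro sum_mono) (auto simp: divide_le_eq power2_eq_square mult_ac)
  then have "(\<Sum>i\<in>J. z i / p i) \<le> (1 + \<eta>) * P" by (simp only: P_def sum_distrib_left)
  moreover have "(\<Sum>i\<in>{..<d} - J. z i / p i) \<le> d * \<eta> * P"
  proof (rule rest)
    fix i assume i: "i \<in> {..<d} - J"
    then have "z i \<le> \<eta> * p j0 * p i" using neg[OF i] by (simp add: mult_ac)
    then show "z i / p i \<le> \<eta> * p j0" using p[of i] i by (simp add: divide_le_eq)
  qed
  ultimately have 2: "(\<Sum>i<d. z i / p i) \<le> (1 + \<eta> + d * \<eta>) * P"
    unfolding split[of "\<lambda>i. z i / p i"] by (simp add: algebra_simps)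
  have "(\<Sum>i\<in>J. (1 - \<eta>) * p i) \<le> (\<Sum>i\<in>J. m i)" using dom by (intro sum_mono) auto
  then have 3: "(1 - \<eta>) * P \<le> (\<Sum>i<d. m i)"
    using split[of m] sum_nonneg[of "{..<d} - J" m] m by (simp add: P_def sum_distrib_left[symmetric])
  have pos: "0 < (1 - \<eta>) * P" using \<eta> P by simp
  then show "0 < (\<Sum>i<d. m i)" using 3 by simp
  have sq: "((1 - \<eta>) * P)\<^sup>2 \<le> (\<Sum>i<d. m i)\<^sup>2" using 3 pos by (intro power_mono) auto
  have "(\<Sum>i<d. p i) * (\<Sum>i<d. z i / p i) \<le> (\<Sum>i<d. p i) * ((1 + \<eta> + d * \<eta>) * P)"
    using 2 p by (intro mult_left_mono sum_nonneg) (auto intro: less_imp_le)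
  also have "\<dots> \<le> ((1 + d * \<eta>) * P) * ((1 + \<eta> + d * \<eta>) * P)"
    using 1 \<eta> P by (intro mult_right_mono) auto
  finally have "(\<Sum>i<d. p i) * (\<Sum>i<d. z i / p i) / (\<Sum>i<d. m i)\<^sup>2
      \<le> ((1 + d * \<eta>) * P) * ((1 + \<eta> + d * \<eta>) * P) / ((1 - \<eta>) * P)\<^sup>2"
    using sq pos \<eta> P by (intro frac_le) auto
  also have "\<dots> = (1 + d * \<eta>) * (1 + \<eta> + d * \<eta>) / (1 - \<eta>)\<^sup>2"
    using P by (simp add: power2_eq_square)
  finally show "(\<Sum>i<d. p i) * (\<Sum>i<d. z i / p i) / (\<Sum>i<d. m i)\<^sup>2
      \<le> (1 + d * \<eta>) * (1 + \<eta> + d * \<eta>) / (1 - \<eta>)\<^sup>2" .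
qed

theorem theorem1:
  fixes d :: nat
    and lam beta :: "nat \<Rightarrow> real"
    and \<gamma> :: real
    and g :: "real \<Rightarrow> real"
    and \<sigma> :: "real \<Rightarrow> nat \<Rightarrow> nat \<Rightarrow> real"
    and A :: "real \<Rightarrow> nat \<Rightarrow> nat \<Rightarrow> nat \<Rightarrow> real"
  assumes d2: "d \<ge> 2"
    and lam_pos: "\<forall>i<d. lam i > 0"
    and beta_pos: "\<forall>i<d. beta i > 0"
    and g_pos: "\<forall>u>0. g u > 0"
    and g_lim: "(g \<longlongrightarrow> \<gamma>) at_top"
    and gamma_pos: "\<gamma> > 0"
    and sigma_diag: "\<forall>u>0. \<forall>i<d. \<sigma> u i i = 1"
    and sigma_sym: "\<forall>u>0. \<forall>i<d. \<forall>k<d. \<sigma> u i k = \<sigma> u k i"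
    and sigma_pd: "\<forall>u>0. \<forall>x::nat \<Rightarrow> real. (\<exists>i<d. x i \<noteq> 0) \<longrightarrow>
                      (\<Sum>i<d. \<Sum>k<d. x i * \<sigma> u i k * x k) > 0"
    and A_fact: "\<forall>u>0. \<forall>j<d. \<forall>i<d. \<forall>k<d. (\<Sum>l<d. A u j i l * A u j k l) = \<sigma> u i k"
    and A_row: "\<forall>u>0. \<forall>j<d. \<forall>k<d. A u j j k = (if k = j then 1 else 0)"
    and A_nonsing: "\<forall>u>0. \<forall>j<d. \<forall>x::nat \<Rightarrow> real.
                      (\<forall>i<d. (\<Sum>k<d. A u j i k * x k) = 0) \<longrightarrow> (\<forall>k<d. x k = 0)"
    and cond: "\<forall>c>0. \<forall>\<epsilon>>0. \<exists>u0>0. \<forall>u>u0. \<forall>j<d. \<forall>i<d.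
                 beta j = Max (beta ` {..<d}) \<and> i \<noteq> j \<longrightarrow>
                 \<sigma> u i j + c * sqrt ((1 - (\<sigma> u i j)\<^sup>2) / ln u)
                   \<le> (beta j / beta i) * (ln (\<epsilon> * e_star lam beta (g u) u i) / ln u)"
  shows "(\<forall>u>0. \<forall>j<d. integral\<^sup>L (jointNI d lam beta (g u) u) (Z_MAK d lam beta (g u) (A u) u)
                      = alpha_j d lam beta (g u) (A u j) u)
       \<and> ((\<lambda>u. integral\<^sup>L (jointNI d lam beta (g u) u) (\<lambda>\<omega>. (Z_MAK d lam beta (g u) (A u) u \<omega>)\<^sup>2)
                 / (alpha_j d lam beta (g u) (A u 0) u)\<^sup>2) \<longlongrightarrow> 1) at_top"
proof (intro conjI allI impI)
  let ?p = "\<lambda>u i. ptail lam beta (g u) u i"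
  let ?J = "{j. j < d \<and> beta j = Max (beta ` {..<d})}"
  have d0: "d > 0" using d2 by simp
  have lam: "lam i > 0" and bet: "beta i > 0" if "i < d" for i
    using lam_pos beta_pos that by auto
  have g: "g u > 0" if "u > 0" for u using g_pos that by auto
  have row: "A u j j k = (if k = j then 1 else 0)" if "u > 0" "j < d" "k < d" for u j k
    using A_row that by blast
  have fct: "(\<Sum>l<d. A u j i l * A u j k l) = \<sigma> u i k" if "u > 0" "j < d" "i < d" "k < d" for u j i k
    using A_fact that by blast
  have unit: "(\<Sum>l<d. (A u j i l)\<^sup>2) = 1" if "u > 0" "j < d" "i < d" for u j i
    using fct[OF that that(3)] sigma_diag that by (simp add: power2_eq_square)
  \<comment> \<open>Row \<open>j\<close> is the unit vector \<open>j\<close>, so the inner product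
    of rows \<open>i\<close> and \<open>j\<close> picks out this entry. The correlation condition
    thereby becomes one on the matrix entries.\<close>
  have entry: "A u j i j = \<sigma> u i j" if "u > 0" "j < d" "i < d" for u j i
  proof -
    have "(\<Sum>l<d. A u j i l * A u j j l) = (\<Sum>l<d. if l = j then A u j i j else 0)"
      using that by (intro sum.cong) (auto simp: row)
    then show ?thesis using fct[OF that that(2)] that by simp
  qed
  have p: "?p u i = gauss_tail (level lam beta (g u) u i)" if "u > 0" "i < d" for u i
    using that lam bet g by (intro ptail_eq_gauss_tail) auto
  then have p_pos: "?p u i > 0" if "u > 0" "i < d" for u i
    using that gauss_tail_pos by simp
  have sum_Z: "(\<Sum>i<d. \<integral>n. Zcond d lam beta (g u) (A u i) u i n \<partial>gaussN d) = alpha_j d lam beta (g u) (A u j) u"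
    if u: "u > 0" and j: "j < d" for u j
    by (rule sum_integral_Zcond[where \<sigma> = "\<sigma> u"]) (use u j lam bet g d0 fct sigma_pd in auto)
  show unbiased: "integral\<^sup>L (jointNI d lam beta (g u) u) (Z_MAK d lam beta (g u) (A u) u)
      = alpha_j d lam beta (g u) (A u j) u" if "u > 0" "j < d" for u j
    using integral_Z_MAK[OF p_pos[OF that(1)] d0, of "A u"] sum_Z[OF that] by simp
  let ?R = "\<lambda>u. integral\<^sup>L (jointNI d lam beta (g u) u) (\<lambda>\<omega>. (Z_MAK d lam beta (g u) (A u) u \<omega>)\<^sup>2)
                 / (alpha_j d lam beta (g u) (A u 0) u)\<^sup>2"
  have "Max (beta ` {..<d}) \<in> beta ` {..<d}" using d0 by (intro Max_in) auto
  \<comment> \<open>The reference index against which all tails outside \<open>?J\<close> are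
    negligible.\<close>
  then obtain j0 where j0: "j0 \<in> ?J" by auto
  have le_J: "beta i \<le> beta j" if "j \<in> ?J" "i < d" for i j
    using that by auto
  have main: "eventually (\<lambda>u. 0 < alpha_j d lam beta (g u) (A u 0) u \<and>
      ?R u \<le> (1 + d * \<eta>) * (1 + \<eta> + d * \<eta>) / (1 - \<eta>)\<^sup>2) at_top" if \<eta>: "0 < \<eta>" "\<eta> < 1" for \<eta> :: real
  proof -
    have "eventually (\<lambda>u. \<forall>j\<in>?J. (\<integral>n. (Zcond d lam beta (g u) (A u j) u j n)\<^sup>2 \<partial>gaussN d)
             \<le> (1 + \<eta>) * (gauss_tail (level lam beta (g u) u j))\<^sup>2
         \<and> (1 - \<eta>) * gauss_tail (level lam beta (g u) u j)
             \<le> (\<integral>n. Zcond d lam beta (g u) (A u j) u j n \<partial>gaussN d)) at_top"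
    proof (intro eventually_ball_finite ballI)
      fix j assume J: "j \<in> ?J"
      then have j: "j < d" by simp
      show "eventually (\<lambda>u. (\<integral>n. (Zcond d lam beta (g u) (A u j) u j n)\<^sup>2 \<partial>gaussN d)
             \<le> (1 + \<eta>) * (gauss_tail (level lam beta (g u) u j))\<^sup>2
         \<and> (1 - \<eta>) * gauss_tail (level lam beta (g u) u j)
             \<le> (\<integral>n. Zcond d lam beta (g u) (A u j) u j n \<partial>gaussN d)) at_top"
      proof (rule Zcond_moments_dominant[where d = d and lam = lam and beta = beta and g = g and j = j and \<eta> = \<eta>,
          OF lam bet g g_lim gamma_pos j le_J[OF J] \<eta>(1)])
        fix i and c \<epsilon> :: real assume i: "i < d" "i \<noteq> j" and "c > 0" "\<epsilon> > 0"
        then obtain u0 where u0: "u0 > 0" "\<forall>u>u0. \<forall>j<d. \<forall>i<d. beta j = Max (beta ` {..<d}) \<and> i \<noteq> j \<longrightarrow>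
                 \<sigma> u i j + c * sqrt ((1 - (\<sigma> u i j)\<^sup>2) / ln u)
                   \<le> (beta j / beta i) * (ln (\<epsilon> * e_star lam beta (g u) u i) / ln u)"
          using cond by blast
        show "eventually (\<lambda>u. A u j i j + c * sqrt ((1 - (A u j i j)\<^sup>2) / ln u)
           \<le> beta j / beta i * (ln (\<epsilon> * e_star lam beta (g u) u i) / ln u)) at_top"
          using eventually_gt_at_top[of u0]
          by eventually_elim (use u0 i j J entry in auto)
      qed (use j row unit in auto)
    qed simp
    moreover have "eventually (\<lambda>u. \<forall>j\<in>{..<d} - ?J. (\<integral>n. (Zcond d lam beta (g u) (A u j) u j n)\<^sup>2 \<partial>gaussN d)
           \<le> \<eta> * gauss_tail (level lam beta (g u) u j) * gauss_tail (level lam beta (g u) u j0)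
         \<and> gauss_tail (level lam beta (g u) u j) \<le> \<eta> * gauss_tail (level lam beta (g u) u j0)) at_top"
    proof (intro eventually_ball_finite ballI)
      fix j assume j: "j \<in> {..<d} - ?J"
      have "beta j \<le> beta j0" using j by (intro le_J[OF j0]) simp
      moreover have "beta j \<noteq> beta j0" using j j0 by auto
      ultimately have "beta j < beta j0" by simp
      then show "eventually (\<lambda>u. (\<integral>n. (Zcond d lam beta (g u) (A u j) u j n)\<^sup>2 \<partial>gaussN d)
           \<le> \<eta> * gauss_tail (level lam beta (g u) u j) * gauss_tail (level lam beta (g u) u j0)
         \<and> gauss_tail (level lam beta (g u) u j) \<le> \<eta> * gauss_tail (level lam beta (g u) u j0)) at_top"
        using j j0 row by (intro Zcond_moment_negligible[where d = d and lam = lam and beta = beta and g = g,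
          OF lam bet g g_lim gamma_pos _ _ _ \<eta>(1)]) auto
    qed simp
    ultimately show ?thesis
      using eventually_gt_at_top[of "0::real"]
    proof eventually_elim
      case (elim u)
      let ?z = "\<lambda>i. \<integral>n. (Zcond d lam beta (g u) (A u i) u i n)\<^sup>2 \<partial>gaussN d"
      let ?m = "\<lambda>i. \<integral>n. Zcond d lam beta (g u) (A u i) u i n \<partial>gaussN d"
      have m0: "?m i \<ge> 0" for i by (intro integral_nonneg_AE) (auto intro: Zcond_bounds)
      have dom: "?z j \<le> (1 + \<eta>) * (?p u j)\<^sup>2 \<and> (1 - \<eta>) * ?p u j \<le> ?m j" if "j \<in> ?J" for j
        using elim(1) that p[OF elim(3)] by auto
      have neg: "?z j \<le> \<eta> * ?p u j * ?p u j0 \<and> ?p u j \<le> \<eta> * ?p u j0" if "j \<in> {..<d} - ?J" for j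
        using elim(2) that j0 p[OF elim(3)] by auto
      have J: "?J \<subseteq> {..<d}" by auto
      note * = second_moment_ratio_le[where d = d and p = "?p u" and z = ?z and m = ?m,
          OF J j0 \<eta> p_pos[OF elim(3)] m0 dom neg]
      have "?R u = (\<Sum>i<d. ?p u i) * (\<Sum>i<d. ?z i / ?p u i) / (\<Sum>i<d. ?m i)\<^sup>2"
        using integral_Z_MAK_square[OF p_pos[OF elim(3)] d0, of "A u"] sum_Z[OF elim(3) d0] by simp
      then show ?case using * sum_Z[OF elim(3) d0] by simp
    qed
  qed
  have "eventually (\<lambda>u. 0 < alpha_j d lam beta (g u) (A u 0) u) at_top"
    using main[of "1 / 2"] by (auto elim: eventually_mono)
  \<comment> \<open>The variance is nonnegative and the mean is \<open>alpha_j\<close>, so the ratio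
    cannot fall below 1.\<close>
  then have ge_1: "eventually (\<lambda>u. 1 \<le> ?R u) at_top"
    using eventually_gt_at_top[of "0::real"]
  proof eventually_elim
    case (elim u)
    let ?M = "jointNI d lam beta (g u) u" and ?Z = "Z_MAK d lam beta (g u) (A u) u"
    interpret M: prob_space ?M by (rule prob_space_jointNI[OF p_pos[OF elim(2)] d0])
    obtain C where C: "\<bar>?Z \<omega>\<bar> \<le> C" for \<omega>
      using Z_MAK_bounded[OF p_pos[OF elim(2)] d0] by blast
    have [measurable]: "?Z \<in> borel_measurable ?M" by (rule measurable_Z_MAK)
    have "integrable ?M ?Z" using C by (intro M.integrable_const_bound[where B = C]) auto
    moreover have "integrable ?M (\<lambda>\<omega>. (?Z \<omega>)\<^sup>2)"
      using power_mono[OF C, where n = 2] by (intro M.integrable_const_bound[where B = "C\<^sup>2"]) auto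
    ultimately have "0 \<le> integral\<^sup>L ?M (\<lambda>\<omega>. (?Z \<omega>)\<^sup>2) - (integral\<^sup>L ?M ?Z)\<^sup>2"
      using M.variance_eq[of ?Z] M.variance_positive[of ?Z] by simp
    then show ?case
      using elim unbiased[OF elim(2) d0] by (simp add: le_divide_eq)
  qed
  show "(?R \<longlongrightarrow> 1) at_top"
  proof (rule order_tendstoI)
    fix a :: real assume "a < 1"
    then show "eventually (\<lambda>u. a < ?R u) at_top" using ge_1 by (auto elim: eventually_mono)
  next
    \<comment> \<open>The bound of \<open>main\<close> tends to 1 as \<open>\<eta>\<close> decreases
      to 0, so some \<open>\<eta>\<close> between 0 and 1 brings it below \<open>a\<close>.\<close>
    fix a :: real assume a: "1 < a"
    have "((\<lambda>\<eta>::real. (1 + d * \<eta>) * (1 + \<eta> + d * \<eta>) / (1 - \<eta>)\<^sup>2) \<longlongrightarrow> (1 + d * 0) * (1 + 0 + d * 0) / (1 - 0)\<^sup>2) (at_right 0)"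
      by (auto intro!: tendsto_eq_intros)
    then have "eventually (\<lambda>\<eta>::real. (1 + d * \<eta>) * (1 + \<eta> + d * \<eta>) / (1 - \<eta>)\<^sup>2 < a) (at_right 0)"
      using a by (intro order_tendstoD(2)) auto
    moreover have "eventually (\<lambda>\<eta>::real. \<eta> \<in> {0<..<1}) (at_right 0)"
      by (rule eventually_at_right_real) simp
    ultimately have "eventually (\<lambda>\<eta>::real. (1 + d * \<eta>) * (1 + \<eta> + d * \<eta>) / (1 - \<eta>)\<^sup>2 < a \<and> \<eta> \<in> {0<..<1}) (at_right 0)"
      by (rule eventually_conj)
    then have "\<exists>\<eta>::real. (1 + d * \<eta>) * (1 + \<eta> + d * \<eta>) / (1 - \<eta>)\<^sup>2 < a \<and> \<eta> \<in> {0<..<1}"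
      by (rule eventually_happens'[rotated]) simp
    then obtain \<eta> :: real where \<eta>: "0 < \<eta>" "\<eta> < 1" "(1 + d * \<eta>) * (1 + \<eta> + d * \<eta>) / (1 - \<eta>)\<^sup>2 < a"
      unfolding greaterThanLessThan_iff by blast
    show "eventually (\<lambda>u. ?R u < a) at_top"
      using main[OF \<eta>(1,2)] by eventually_elim (use \<eta>(3) in auto)
  qed
qed

end
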